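(* Let $c_1,c_2\ge 1$ be integers with $c_2\leq c_1\leq 2c_2$ and $c_1\neq 1\neq c_2$. Then a finitely generated abelian group is $[\mathfrak{N}_{c_1},\mathfrak{N}_{c_2}]$-capable if and only if it is capable.
   Context: A group $G$ is capable if there is a group $E$ with $G\cong E/Z(E)$. For a set of words $V$ defining a variety $\mathfrak V$ and a group $E$, the marginal subgroup $V^*(E)$ is the set of all $a\in E$ such that $v(g_1,\dots,g_{i-1},g_ia,g_{i+1},\dots,g_n)=v(g_1,\dots,g_n)$ for all $v\in V$, all $g_1,\dots,g_n\in E$ and all $1\le i\le n$. A group $G$ is $\mathfrak V$-capable if there is a group $E$ with $G\cong E/V^*(E)$ (so capable means capable for the variety of abelian groups). $[\mathfrak{N}_{c_1},\mathfrak{N}_{c_2}]$ is the outer commutator variety defined by the single word $[[x_1,\dots,x_{c_1+1}],[y_1,\dots,y_{c_2+1}]]$ (left-normed commutators in distinct variables), i.e. the variety of groups $G$ with $[\gamma_{c_1+1}(G),\gamma_{c_2+1}(G)]=1$. *)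

theory Defs
  imports "HOL-Algebra.Algebra"
begin

text \<open>A word is a list of letters, where \<open>(i, True)\<close> stands for \<open>x\<^sub>i\<close> and
  \<open>(i, False)\<close> for its inverse. Words need not be reduced: only their values in groups matter.\<close>

type_synonym word = "(nat \<times> bool) list"

definition wvar :: "nat \<Rightarrow> word" where
  "wvar i = [(i, True)]"

definition winv :: "word \<Rightarrow> word" where
  "winv u = rev (map (\<lambda>(i, s). (i, \<not> s)) u)"

definition wcomm :: "word \<Rightarrow> word \<Rightarrow> word" where
  "wcomm u v = winv u @ winv v @ u @ v"

text \<open>The left-normed commutator \<open>[x\<^sub>s, x\<^sub>s\<^sub>+\<^sub>1, \<dots>, x\<^sub>s\<^sub>+\<^sub>k]\<close> of weight \<open>k + 1\<close>.\<close>

primrec left_normed_comm :: "nat \<Rightarrow> nat \<Rightarrow> word" where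
  "left_normed_comm s 0 = wvar s"
| "left_normed_comm s (Suc k) = wcomm (left_normed_comm s k) (wvar (s + Suc k))"

text \<open>The variables \<open>x\<^sub>1, \<dots>, x\<^sub>c\<^sub>1\<^sub>+\<^sub>1\<close> have the indices \<open>0, \<dots>, c1\<close>, and \<open>y\<^sub>1, \<dots>, y\<^sub>c\<^sub>2\<^sub>+\<^sub>1\<close> the
  indices \<open>c1 + 1, \<dots>, c1 + c2 + 1\<close>.\<close>

definition outer_comm_word :: "nat \<Rightarrow> nat \<Rightarrow> word" where
  "outer_comm_word c1 c2 = wcomm (left_normed_comm 0 c1) (left_normed_comm (Suc c1) c2)"

primrec word_value :: "('a, 'm) monoid_scheme \<Rightarrow> (nat \<Rightarrow> 'a) \<Rightarrow> word \<Rightarrow> 'a" where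
  "word_value E g [] = \<one>\<^bsub>E\<^esub>"
| "word_value E g (l # w) =
     (if snd l then g (fst l) else inv\<^bsub>E\<^esub> (g (fst l))) \<otimes>\<^bsub>E\<^esub> word_value E g w"

text \<open>Values are assigned to all variables \<open>x\<^sub>i\<close> at once; those not occurring in \<open>v\<close> have no
  influence on its value, so the condition is vacuous for them.\<close>

definition marginal :: "word set \<Rightarrow> ('a, 'm) monoid_scheme \<Rightarrow> 'a set" where
  "marginal V E = {a \<in> carrier E. \<forall>v\<in>V. \<forall>g. (\<forall>j. g j \<in> carrier E) \<longrightarrow>
     (\<forall>i. word_value E (g(i := g i \<otimes>\<^bsub>E\<^esub> a)) v = word_value E g v)}"

definition center :: "('a, 'm) monoid_scheme \<Rightarrow> 'a set" where
  "center E = {a \<in> carrier E. \<forall>b\<in>carrier E. a \<otimes>\<^bsub>E\<^esub> b = b \<otimes>\<^bsub>E\<^esub> a}"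

definition finitely_generated :: "('a, 'm) monoid_scheme \<Rightarrow> bool" where
  "finitely_generated G \<longleftrightarrow> (\<exists>S. finite S \<and> S \<subseteq> carrier G \<and> generate G S = carrier G)"

text \<open>HOL cannot quantify over types inside a formula, so the type \<open>'b\<close> of the elements of the
  witness \<open>E\<close> is a parameter. For finitely generated \<open>G\<close> every infinite \<open>'b\<close> gives the same
  notion: if \<open>G \<cong> E/V\<^sup>*(E)\<close>, choose a finitely generated \<open>H \<le> E\<close> with \<open>E = H V\<^sup>*(E)\<close>; then
  \<open>V\<^sup>*(H) = H \<inter> V\<^sup>*(E)\<close>, so the countable group \<open>H\<close> also satisfies \<open>G \<cong> H/V\<^sup>*(H)\<close>, and it
  has an isomorphic copy whose elements have type \<open>'b\<close>. The same argument applies to the centre.\<close>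

definition variety_capable :: "'b itself \<Rightarrow> word set \<Rightarrow> ('a, 'm) monoid_scheme \<Rightarrow> bool" where
  "variety_capable T V G \<longleftrightarrow> (\<exists>E :: 'b monoid. group E \<and> G \<cong> E Mod marginal V E)"

definition capable :: "'b itself \<Rightarrow> ('a, 'm) monoid_scheme \<Rightarrow> bool" where
  "capable T G \<longleftrightarrow> (\<exists>E :: 'b monoid. group E \<and> G \<cong> E Mod center E)"

end

theory Submission
  imports Defs "HOL-Library.Countable"
begin

text \<open>Write \<open>G\<close> as a direct sum of cyclic groups \<open>\<langle>b\<^sub>0\<rangle> \<oplus> \<dots> \<oplus> \<langle>b\<^sub>k\<^sub>+\<^sub>1\<rangle>\<close> of orders \<open>n\<^sub>0 | n\<^sub>1 | \<dots> | n\<^sub>k\<^sub>+\<^sub>1\<close>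
  (0 meaning infinite order). Both properties are equivalent to \<open>n\<^sub>k = n\<^sub>k\<^sub>+\<^sub>1\<close>, and ordinary
  capability is the case \<open>c1 = c2 = 0\<close>, because the centre is the marginal subgroup of \<open>[x, y]\<close>.

  If \<open>G \<cong> E/V\<^sup>*(E)\<close>, then the word is multiplicative in each variable and factors through the
  abelian group \<open>G\<close>. Its \<open>n\<^sub>k\<close>-th power is trivial on generators: if one of them is not \<open>b\<^sub>k\<^sub>+\<^sub>1\<close>,
  move the exponent there, and otherwise all arguments are equal. Hence the \<open>n\<^sub>k\<close>-th power of a
  lift of \<open>b\<^sub>k\<^sub>+\<^sub>1\<close> is marginal.

  Conversely, \<open>E\<close> is a truncated group of noncommutative power series with constant term 1. There
  the word depends only on the linear parts of its arguments, through the corresponding Lie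
  bracket in the free associative algebra, and the coefficient of one monomial shows that the
  marginal elements are those with trivial linear part.\<close>

section \<open>Diagonal bases of finitely generated abelian groups\<close>

context comm_group
begin

definition lin_comb :: "nat \<Rightarrow> (nat \<Rightarrow> 'a) \<Rightarrow> (nat \<Rightarrow> int) \<Rightarrow> 'a" where
  "lin_comb k a z = (\<Otimes>i\<in>{..<k}. a i [^] z i)"

definition tuple_span :: "nat \<Rightarrow> (nat \<Rightarrow> 'a) \<Rightarrow> 'a set" where
  "tuple_span k a = range (lin_comb k a)"

lemma lin_comb_closed [simp, intro]: "a \<in> {..<k} \<rightarrow> carrier G \<Longrightarrow> lin_comb k a z \<in> carrier G"
  unfolding lin_comb_def by (rule finprod_closed) auto

lemma lin_comb_cong:
  assumes "a \<in> {..<k} \<rightarrow> carrier G" "\<And>i. i < k \<Longrightarrow> a i = b i" "\<And>i. i < k \<Longrightarrow> z i = y i"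
  shows "lin_comb k a z = lin_comb k b y"
  unfolding lin_comb_def using assms by (intro finprod_cong') (auto simp: Pi_def)

lemma lin_comb_add:
  assumes "a \<in> {..<k} \<rightarrow> carrier G"
  shows "lin_comb k a (\<lambda>i. y i + z i) = lin_comb k a y \<otimes> lin_comb k a z"
proof -
  have "lin_comb k a (\<lambda>i. y i + z i) = (\<Otimes>i\<in>{..<k}. a i [^] y i \<otimes> a i [^] z i)"
    unfolding lin_comb_def using assms by (intro finprod_cong') (auto simp: Pi_def int_pow_mult)
  also have "\<dots> = lin_comb k a y \<otimes> lin_comb k a z"
    unfolding lin_comb_def using assms by (intro finprod_multf) (auto simp: Pi_def)
  finally show ?thesis .
qed

lemma lin_comb_zero: "(\<And>i. i < k \<Longrightarrow> a i [^] z i = \<one>) \<Longrightarrow> lin_comb k a z = \<one>"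
  unfolding lin_comb_def by (rule finprod_one_eqI) auto

lemma lin_comb_Suc:
  assumes "a \<in> {..<Suc k} \<rightarrow> carrier G"
  shows "lin_comb (Suc k) a z = a 0 [^] z 0 \<otimes> lin_comb k (\<lambda>i. a (Suc i)) (\<lambda>i. z (Suc i))"
proof -
  have *: "{..<Suc k} = insert 0 (Suc ` {..<k})" by (auto simp: lessThan_Suc_eq_insert_0)
  have "lin_comb (Suc k) a z = a 0 [^] z 0 \<otimes> (\<Otimes>i\<in>Suc ` {..<k}. a i [^] z i)"
    unfolding lin_comb_def * using assms by (intro finprod_insert) (auto simp: Pi_def)
  also have "(\<Otimes>i\<in>Suc ` {..<k}. a i [^] z i) = lin_comb k (\<lambda>i. a (Suc i)) (\<lambda>i. z (Suc i))"
    unfolding lin_comb_def using assms by (intro finprod_reindex) (auto simp: Pi_def)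
  finally show ?thesis .
qed

lemma lin_comb_neg:
  assumes "a \<in> {..<k} \<rightarrow> carrier G"
  shows "lin_comb k a (\<lambda>i. - z i) = inv (lin_comb k a z)"
proof -
  have "lin_comb k a (\<lambda>i. - z i) \<otimes> lin_comb k a z = \<one>"
    unfolding lin_comb_add [OF assms, symmetric] by (rule lin_comb_zero) simp
  then show ?thesis using assms by (simp add: inv_equality)
qed

lemma lin_comb_mult:
  assumes "a \<in> {..<k} \<rightarrow> carrier G"
  shows "lin_comb k a (\<lambda>i. z i * c) = lin_comb k a z [^] (c::int)"
proof (cases c rule: int_cases2)
  have nn: "lin_comb k a (\<lambda>i. z i * int n) = lin_comb k a z [^] int n" for n z
  proof (induction n)
    case 0
    then show ?case using assms by (simp add: lin_comb_zero)
  next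
    case (Suc n)
    then show ?case
      using lin_comb_add [OF assms, of z "\<lambda>i. z i * int n"] assms
      by (simp add: algebra_simps int_pow_mult)
  qed
  {
    case (nonneg n)
    then show ?thesis using nn by simp
  next
    case (nonpos n)
    then show ?thesis
      using nn [of z n] lin_comb_neg [OF assms, of "\<lambda>i. z i * int n"] assms
      by (simp add: int_pow_neg)
  }
qed

lemma lin_comb_unit:
  assumes "a \<in> {..<k} \<rightarrow> carrier G" "i < k"
  shows "lin_comb k a (\<lambda>j. if j = i then c else 0) = a i [^] c"
proof -
  have "lin_comb k a (\<lambda>j. if j = i then c else 0)
      = (\<Otimes>j\<in>{..<k}. if j = i then a j [^] c else \<one>)"
    unfolding lin_comb_def using assms by (intro finprod_cong') (auto simp: Pi_def)
  also have "\<dots> = a i [^] c"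
    using assms by (intro finprod_singleton_swap) (auto simp: Pi_def)
  finally show ?thesis .
qed

lemma lin_comb_transpose:
  assumes "a \<in> {..<k} \<rightarrow> carrier G" "i < k" "j < k"
  shows "lin_comb k (a \<circ> transpose i j) (z \<circ> transpose i j) = lin_comb k a z"
proof -
  have im: "transpose i j ` {..<k} = {..<k}"
    using assms(2,3) by (simp add: transpose_image_eq)
  have "finprod G (\<lambda>l. a l [^] z l) (transpose i j ` {..<k})
      = (\<Otimes>l\<in>{..<k}. a (transpose i j l) [^] z (transpose i j l))"
    using assms(1) by (intro finprod_reindex) (auto simp: im Pi_def)
  then show ?thesis unfolding lin_comb_def im by simp
qed

lemma tuple_span_subgroup:
  assumes "a \<in> {..<k} \<rightarrow> carrier G"
  shows "subgroup (tuple_span k a) G"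
proof (rule subgroupI)
  show "inv x \<in> tuple_span k a" if "x \<in> tuple_span k a" for x
    using that assms unfolding tuple_span_def by (auto simp: lin_comb_neg [symmetric])
  show "x \<otimes> y \<in> tuple_span k a" if "x \<in> tuple_span k a" "y \<in> tuple_span k a" for x y
    using that assms unfolding tuple_span_def by (auto simp: lin_comb_add [symmetric])
qed (use assms in \<open>auto simp: tuple_span_def\<close>)

lemma tuple_span_mem: "a \<in> {..<k} \<rightarrow> carrier G \<Longrightarrow> i < k \<Longrightarrow> a i \<in> tuple_span k a"
  using lin_comb_unit [of a k i 1] unfolding tuple_span_def by (metis PiE int_pow_1 lessThan_iff rangeI)

lemma lin_comb_in_subgroup:
  assumes "subgroup H G" "\<And>i. i < k \<Longrightarrow> a i \<in> H"
  shows "lin_comb k a z \<in> H"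
  using assms(2)
proof (induction k arbitrary: a z)
  case 0
  then show ?case using assms(1) by (simp add: lin_comb_def subgroup.one_closed)
next
  case (Suc k)
  have "a \<in> {..<Suc k} \<rightarrow> carrier G" using Suc.prems assms(1) by (auto dest: subgroup.mem_carrier)
  then show ?case
    using Suc assms(1) by (simp add: lin_comb_Suc subgroup.m_closed subgroup_int_pow_closed)
qed

lemma tuple_span_eqI:
  assumes "a \<in> {..<k} \<rightarrow> carrier G" "b \<in> {..<l} \<rightarrow> carrier G"
    and "\<And>i. i < k \<Longrightarrow> a i \<in> tuple_span l b" "\<And>i. i < l \<Longrightarrow> b i \<in> tuple_span k a"
  shows "tuple_span k a = tuple_span l b"
  using assms tuple_span_subgroup lin_comb_in_subgroup unfolding tuple_span_def by blast

text \<open>Euclidean division: with \<open>z j = r + q * c\<close>, replacing \<open>a 0\<close> by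
  \<open>a 0 \<otimes> a j [^] q\<close> keeps the span and turns the relation into one whose
  coefficient at \<open>j\<close> is \<open>r < c\<close>, so minimality of \<open>c\<close> forces
  \<open>r = 0\<close>.\<close>

lemma relation_coeff_dvd:
  assumes a: "a \<in> {..<k} \<rightarrow> carrier G" and rel: "lin_comb k a z = \<one>" and "0 < k"
    and c: "z 0 = c" "0 < c"
    and min: "\<And>b y i. \<lbrakk>b \<in> {..<k} \<rightarrow> carrier G; tuple_span k b = tuple_span k a; lin_comb k b y = \<one>;
        i < k; y i \<noteq> 0\<rbrakk> \<Longrightarrow> c \<le> \<bar>y i\<bar>"
    and "j < k"
  shows "c dvd z j"
proof (cases "j = 0")
  case False
  define q r b y where "q = z j div c" and "r = z j mod c"
    and "b = a(0 := a 0 \<otimes> a j [^] q)" and "y = z(j := r)"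
  have zj: "z j = r + q * c" unfolding q_def r_def by simp
  have ac: "a 0 \<in> carrier G" "a j \<in> carrier G" using a \<open>0 < k\<close> \<open>j < k\<close> by auto
  have b: "b \<in> {..<k} \<rightarrow> carrier G" using a ac unfolding b_def by auto
  have sb: "b i \<in> tuple_span k a" if "i < k" for i
    using tuple_span_mem [OF a] tuple_span_subgroup [OF a] that \<open>j < k\<close> \<open>0 < k\<close>
    by (auto simp: b_def subgroup.m_closed subgroup_int_pow_closed)
  have "a 0 = b 0 \<otimes> inv (b j [^] q)"
    using False ac by (simp add: b_def m_assoc)
  then have sa0: "a 0 \<in> tuple_span k b"
    using tuple_span_mem [OF b \<open>j < k\<close>] tuple_span_mem [OF b \<open>0 < k\<close>] tuple_span_subgroup [OF b]
    by (metis subgroup.m_closed subgroup.m_inv_closed subgroup_int_pow_closed)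
  have sa: "a i \<in> tuple_span k b" if "i < k" for i
  proof (cases "i = 0")
    case False
    then have "b i = a i" by (simp add: b_def)
    then show ?thesis using tuple_span_mem [OF b that] by simp
  qed (simp add: sa0)
  have span: "tuple_span k b = tuple_span k a" by (rule tuple_span_eqI [OF b a sb sa])
  have "lin_comb k b y = (\<Otimes>i\<in>{..<k}. a i [^] y i \<otimes> (if i = 0 then a j [^] (q * c) else \<one>))"
    unfolding lin_comb_def using a ac False c
    by (intro finprod_cong') (auto simp: Pi_def b_def y_def int_pow_distrib int_pow_pow)
  also have "\<dots> = lin_comb k a y \<otimes> (\<Otimes>i\<in>{..<k}. (if i = 0 then a j [^] (q * c) else \<one>))"
    unfolding lin_comb_def using a ac by (intro finprod_multf) (auto simp: Pi_def)
  also have "(\<Otimes>i\<in>{..<k}. (if i = 0 then a j [^] (q * c) else \<one>)) = a j [^] (q * c)"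
    using ac \<open>0 < k\<close> by (intro finprod_singleton_swap) (auto simp: Pi_def)
  also have "a j [^] (q * c) = lin_comb k a (\<lambda>i. if i = j then q * c else 0)"
    using lin_comb_unit [OF a \<open>j < k\<close>] by simp
  also have "lin_comb k a y \<otimes> \<dots> = lin_comb k a z"
    unfolding lin_comb_add [OF a, symmetric]
    by (rule lin_comb_cong [OF a]) (auto simp: y_def zj)
  finally have "lin_comb k b y = \<one>" using rel by simp
  then have "r \<noteq> 0 \<Longrightarrow> c \<le> \<bar>r\<bar>" using min [OF b span _ \<open>j < k\<close>, of y] by (simp add: y_def)
  moreover have "0 \<le> r" "r < c" using c by (simp_all add: r_def)
  ultimately have "r = 0" by linarith
  then show ?thesis by (simp add: zj)
qed (use c in simp)

text \<open>Only the span of \<open>t\<close> enters the right-hand side, so \<open>t\<close> can be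
  exchanged for any tuple with the same span.\<close>

lemma tuple_span_case_nat:
  assumes "b0 \<in> carrier G" "t \<in> {..<k} \<rightarrow> carrier G"
  shows "tuple_span (Suc k) (case_nat b0 t) = {b0 [^] (m::int) \<otimes> h |m h. h \<in> tuple_span k t}"
proof -
  have *: "case_nat b0 t \<in> {..<Suc k} \<rightarrow> carrier G"
    using assms by (auto simp: less_Suc_eq_0_disj Pi_def)
  have "b0 [^] m \<otimes> lin_comb k t y \<in> range (lin_comb (Suc k) (case_nat b0 t))" for m :: int and y
    using lin_comb_Suc [OF *, of "case_nat m y"] by (intro range_eqI [of _ _ "case_nat m y"]) simp
  then show ?thesis
    unfolding tuple_span_def using lin_comb_Suc [OF *] by auto
qed

text \<open>Among all tuples with the given span, take a relation with the smallest positive coefficient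
  \<open>c\<close>. By minimality \<open>c\<close> divides all coefficients of every relation in which it occurs, so a
  cyclic factor of order \<open>c\<close> splits off. The induction also tracks the common divisors of all
  coefficients of relations: this is what makes \<open>c\<close> divide the remaining orders.\<close>

theorem diagonal_basis:
  assumes "a \<in> {..<k} \<rightarrow> carrier G"
  obtains b n where "b \<in> {..<k} \<rightarrow> carrier G" "tuple_span k b = tuple_span k a"
    and "\<And>z. lin_comb k b z = \<one> \<longleftrightarrow> (\<forall>i<k. int (n i) dvd z i)"
    and "\<And>i. Suc i < k \<Longrightarrow> n i dvd n (Suc i)"
proof -
  define coeffs_dvd where "coeffs_dvd k a d \<longleftrightarrow> (\<forall>b z i. b \<in> {..<k} \<rightarrow> carrier G \<longrightarrow>
    tuple_span k b = tuple_span k a \<longrightarrow> lin_comb k b z = \<one> \<longrightarrow> i < k \<longrightarrow> int d dvd z i)" for k a d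
  have "\<exists>b n. b \<in> {..<k} \<rightarrow> carrier G \<and> tuple_span k b = tuple_span k a
    \<and> (\<forall>z. lin_comb k b z = \<one> \<longleftrightarrow> (\<forall>i<k. int (n i) dvd z i))
    \<and> (\<forall>i. Suc i < k \<longrightarrow> n i dvd n (Suc i))
    \<and> (\<forall>d. coeffs_dvd k a d \<longrightarrow> (\<forall>i<k. d dvd n i))"
    using assms
  proof (induction k arbitrary: a)
    case 0
    then show ?case by (auto simp: lin_comb_def)
  next
    case (Suc k)
    define R where "R = (\<lambda>m. \<exists>b z i. b \<in> {..<Suc k} \<rightarrow> carrier G
      \<and> tuple_span (Suc k) b = tuple_span (Suc k) a \<and> lin_comb (Suc k) b z = \<one> \<and> i < Suc k
      \<and> z i \<noteq> 0 \<and> nat \<bar>z i\<bar> = m)"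
    show ?case
    proof (cases "\<exists>m. R m")
      \<comment> \<open>Without a nontrivial relation the tuple itself is a free basis: all orders
        are 0, and 0 is divisible by everything.\<close>
      case False
      have "lin_comb (Suc k) a z = \<one> \<longleftrightarrow> (\<forall>i<Suc k. int 0 dvd z i)" for z
        using False Suc.prems unfolding R_def by (auto intro: lin_comb_zero)
      then show ?thesis using Suc.prems by (intro exI [of _ a] exI [of _ "\<lambda>_. 0"]) simp
    next
      case True
      define c where "c = (LEAST m. R m)"
      have "R c" unfolding c_def using True by (rule LeastI_ex)
      have min: "int c \<le> \<bar>y i\<bar>" if "b \<in> {..<Suc k} \<rightarrow> carrier G"
        "tuple_span (Suc k) b = tuple_span (Suc k) a" "lin_comb (Suc k) b y = \<one>" "i < Suc k" "y i \<noteq> 0"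
        for b y i
      proof -
        have "R (nat \<bar>y i\<bar>)" unfolding R_def using that by blast
        then have "c \<le> nat \<bar>y i\<bar>" unfolding c_def by (rule Least_le)
        then show ?thesis by linarith
      qed
      obtain a1 z1 i1 where a1: "a1 \<in> {..<Suc k} \<rightarrow> carrier G"
        "tuple_span (Suc k) a1 = tuple_span (Suc k) a" "lin_comb (Suc k) a1 z1 = \<one>" "i1 < Suc k"
        "z1 i1 \<noteq> 0" "nat \<bar>z1 i1\<bar> = c"
        using \<open>R c\<close> unfolding R_def by blast
      then have "0 < c" by auto
      \<comment> \<open>The minimal coefficient is moved to position 0; its sign is corrected when
        \<open>z2\<close> is obtained.\<close>
      define a2 where "a2 = a1 \<circ> transpose 0 i1"
      have a2: "a2 \<in> {..<Suc k} \<rightarrow> carrier G"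
        using a1(1,4) by (auto simp: a2_def transpose_def)
      have "range (\<lambda>z. lin_comb (Suc k) a2 z) = range (lin_comb (Suc k) a1)"
      proof -
        have "lin_comb (Suc k) a2 z = lin_comb (Suc k) a1 (z \<circ> transpose 0 i1)" for z
          using lin_comb_transpose [OF a1(1), of 0 i1 "z \<circ> transpose 0 i1"] a1(4)
          by (simp add: a2_def comp_assoc)
        moreover have "lin_comb (Suc k) a1 z = lin_comb (Suc k) a2 (z \<circ> transpose 0 i1)" for z
          using lin_comb_transpose [OF a1(1), of 0 i1 z] a1(4) by (simp add: a2_def)
        ultimately show ?thesis by (metis (mono_tags) image_subset_iff rangeI subset_antisym)
      qed
      then have span2: "tuple_span (Suc k) a2 = tuple_span (Suc k) a"
        using a1(2) by (simp add: tuple_span_def)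
      obtain z2 where z2: "lin_comb (Suc k) a2 z2 = \<one>" "z2 0 = int c"
      proof -
        have *: "lin_comb (Suc k) a2 (z1 \<circ> transpose 0 i1) = \<one>"
          using lin_comb_transpose [OF a1(1), of 0 i1 z1] a1(3,4) by (simp add: a2_def)
        have **: "lin_comb (Suc k) a2 (\<lambda>i. - (z1 \<circ> transpose 0 i1) i) = \<one>"
          using lin_comb_neg [OF a2, of "z1 \<circ> transpose 0 i1"] * by simp
        from a1(5,6) consider "z1 i1 = int c" | "- z1 i1 = int c" by linarith
        then show ?thesis
        proof cases
          case 1
          show ?thesis by (rule that [OF *]) (use 1 in simp)
        next
          case 2
          show ?thesis by (rule that [OF **]) (use 2 in simp)
        qed
      qed
      have dvd: "int c dvd y j" if "b \<in> {..<Suc k} \<rightarrow> carrier G"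
        "tuple_span (Suc k) b = tuple_span (Suc k) a" "lin_comb (Suc k) b y = \<one>" "y 0 = int c"
        "j < Suc k" for b y j
        by (rule relation_coeff_dvd [OF that(1,3) _ that(4)]) (use that min \<open>0 < c\<close> in auto)
      \<comment> \<open>The whole relation \<open>z2\<close> is \<open>c\<close> times
        \<open>q\<close>, and \<open>q 0 = 1\<close>. Hence \<open>b0\<close>, the combination with
        coefficients \<open>q\<close>, is killed by \<open>c\<close> and can replace
        \<open>a2 0\<close> without changing the span.\<close>
      define q where "q i = z2 i div int c" for i
      have zq: "z2 i = q i * int c" if "i < Suc k" for i
        using dvd [OF a2 span2 z2 that] by (simp add: q_def)
      have q0: "q 0 = 1" using z2(2) \<open>0 < c\<close> by (simp add: q_def)
      define b0 t where "b0 = lin_comb (Suc k) a2 q" and "t = (\<lambda>i. a2 (Suc i))"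
      have b0: "b0 \<in> carrier G" and t: "t \<in> {..<k} \<rightarrow> carrier G"
        using a2 by (auto simp: b0_def t_def)
      have case_mem: "case_nat b0 u \<in> {..<Suc k} \<rightarrow> carrier G" if "u \<in> {..<k} \<rightarrow> carrier G" for u
        using that b0 by (auto simp: less_Suc_eq_0_disj Pi_def)
      have b0c: "b0 [^] int c = \<one>"
        unfolding b0_def lin_comb_mult [OF a2, symmetric] z2(1) [symmetric]
        by (rule lin_comb_cong [OF a2]) (auto simp: zq)
      have b0_eq: "b0 = a2 0 \<otimes> lin_comb k t (\<lambda>i. q (Suc i))"
        using lin_comb_Suc [OF a2] a2 q0 by (simp add: b0_def t_def Pi_def)
      have span_t: "tuple_span (Suc k) (case_nat b0 t) = tuple_span (Suc k) a"
        unfolding span2 [symmetric]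
      proof (rule tuple_span_eqI [OF case_mem [OF t] a2])
        fix i assume "i < Suc k"
        then show "case_nat b0 t i \<in> tuple_span (Suc k) a2"
          using tuple_span_mem [OF a2, of i]
          by (cases i) (auto simp: b0_def t_def tuple_span_def)
      next
        have m: "b0 \<in> tuple_span (Suc k) (case_nat b0 t)"
          using tuple_span_mem [OF case_mem [OF t], of 0] by simp
        have mt: "t i \<in> tuple_span (Suc k) (case_nat b0 t)" if "i < k" for i
          using tuple_span_mem [OF case_mem [OF t], of "Suc i"] that by simp
        note sg = tuple_span_subgroup [OF case_mem [OF t]]
        have "a2 0 = b0 \<otimes> inv (lin_comb k t (\<lambda>i. q (Suc i)))"
          unfolding b0_eq using a2 t by (simp add: m_assoc Pi_def)
        moreover have "lin_comb k t (\<lambda>i. q (Suc i)) \<in> tuple_span (Suc k) (case_nat b0 t)"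
          by (rule lin_comb_in_subgroup [OF sg mt])
        ultimately have "a2 0 \<in> tuple_span (Suc k) (case_nat b0 t)"
          using sg m by (simp add: subgroup.m_closed subgroup.m_inv_closed)
        moreover fix i assume "i < Suc k"
        ultimately show "a2 i \<in> tuple_span (Suc k) (case_nat b0 t)"
          using mt by (cases i) (auto simp: t_def)
      qed
      have span_u: "tuple_span (Suc k) (case_nat b0 u) = tuple_span (Suc k) a"
        if "u \<in> {..<k} \<rightarrow> carrier G" "tuple_span k u = tuple_span k t" for u
        using that span_t t b0 by (simp add: tuple_span_case_nat)
      have lc_u: "lin_comb (Suc k) (case_nat b0 u) z = b0 [^] z 0 \<otimes> lin_comb k u (\<lambda>i. z (Suc i))"
        if "u \<in> {..<k} \<rightarrow> carrier G" for u z
        using lin_comb_Suc [OF case_mem [OF that]] by simp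
      have rel_iff: "lin_comb (Suc k) (case_nat b0 u) z = \<one> \<longleftrightarrow>
          int c dvd z 0 \<and> lin_comb k u (\<lambda>i. z (Suc i)) = \<one>"
        if u: "u \<in> {..<k} \<rightarrow> carrier G" "tuple_span k u = tuple_span k t" for u z
      proof -
        have pow: "b0 [^] y = b0 [^] (y mod int c)" for y
        proof -
          have "b0 [^] (int c * (y div int c) + y mod int c)
              = (b0 [^] int c) [^] (y div int c) \<otimes> b0 [^] (y mod int c)"
            unfolding int_pow_pow [OF b0] by (rule int_pow_mult [OF b0])
          then show ?thesis using b0 b0c by simp
        qed
        have "int c dvd z 0" if rel: "lin_comb (Suc k) (case_nat b0 u) z = \<one>"
        proof (rule ccontr)
          assume "\<not> int c dvd z 0"
          then have nz: "z 0 mod int c \<noteq> 0" by (simp add: dvd_eq_mod_eq_0)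
          \<comment> \<open>Reducing the first coefficient modulo \<open>c\<close> keeps the
            relation; a nonzero remainder would contradict the minimality of \<open>c\<close>. So
            the cyclic factor of \<open>b0\<close> splits off.\<close>
          have "lin_comb (Suc k) (case_nat b0 u) (z(0 := z 0 mod int c)) = \<one>"
            using rel lc_u [OF u(1)] pow [of "z 0"] by simp
          from min [OF case_mem [OF u(1)] span_u [OF u] this, of 0] nz
          have "int c \<le> z 0 mod int c" using \<open>0 < c\<close> by simp
          then show False using pos_mod_bound [of "int c" "z 0"] \<open>0 < c\<close> by linarith
        qed
        moreover have "b0 [^] z 0 = \<one>" if "int c dvd z 0" using pow [of "z 0"] that by simp
        ultimately show ?thesis using lc_u [OF u(1), of z] u(1) by auto
      qed
      obtain b n where b: "b \<in> {..<k} \<rightarrow> carrier G" "tuple_span k b = tuple_span k t"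
        and rel: "\<And>z. lin_comb k b z = \<one> \<longleftrightarrow> (\<forall>i<k. int (n i) dvd z i)"
        and chain: "\<And>i. Suc i < k \<Longrightarrow> n i dvd n (Suc i)"
        and below: "\<And>d i. coeffs_dvd k t d \<Longrightarrow> i < k \<Longrightarrow> d dvd n i"
        using Suc.IH [OF t] by blast
      \<comment> \<open>A relation of \<open>u\<close> extended by the coefficient \<open>c\<close>
        at \<open>b0\<close> is a relation with \<open>c\<close> in front, so \<open>c\<close>
        divides all its coefficients. Thus \<open>c\<close> divides every order found for the
        remaining tuple.\<close>
      have "coeffs_dvd k t c"
        unfolding coeffs_dvd_def
      proof (intro allI impI)
        fix u z i
        assume u: "u \<in> {..<k} \<rightarrow> carrier G" "tuple_span k u = tuple_span k t"
          and "lin_comb k u z = \<one>" "i < k"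
        then have "lin_comb (Suc k) (case_nat b0 u) (case_nat (int c) z) = \<one>"
          by (simp add: rel_iff)
        from dvd [OF case_mem [OF u(1)] span_u [OF u] this, of "Suc i"] \<open>i < k\<close>
        show "int c dvd z i" by simp
      qed
      then have cn: "c dvd n i" if "i < k" for i using below that by blast
      show ?thesis
      proof (intro exI conjI allI impI)
        show "case_nat b0 b \<in> {..<Suc k} \<rightarrow> carrier G" by (rule case_mem [OF b(1)])
        show "tuple_span (Suc k) (case_nat b0 b) = tuple_span (Suc k) a" by (rule span_u [OF b])
        show "lin_comb (Suc k) (case_nat b0 b) z = \<one> \<longleftrightarrow>
          (\<forall>i<Suc k. int (case_nat c n i) dvd z i)" for z
          unfolding rel_iff [OF b] rel by (auto simp: All_less_Suc2)
        show "case_nat c n i dvd case_nat c n (Suc i)" if "Suc i < Suc k" for i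
          using that chain cn by (cases i) auto
        fix d i assume d: "coeffs_dvd (Suc k) a d" and "i < Suc k"
        \<comment> \<open>To pass a common divisor \<open>d\<close> on: \<open>c\<close> is itself a
          coefficient of a relation, and relations of the shorter tuples become relations of the
          longer ones by putting 0 in front.\<close>
        have "int d dvd int c"
          using d a2 span2 z2 unfolding coeffs_dvd_def by (metis zero_less_Suc)
        moreover have "coeffs_dvd k t d"
          unfolding coeffs_dvd_def
        proof (intro allI impI)
          fix u z i
          assume u: "u \<in> {..<k} \<rightarrow> carrier G" "tuple_span k u = tuple_span k t"
            and "lin_comb k u z = \<one>" "i < k"
          then have "lin_comb (Suc k) (case_nat b0 u) (case_nat 0 z) = \<one>"
            by (simp add: rel_iff)
          moreover have "Suc i < Suc k" using \<open>i < k\<close> by simp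
          ultimately have "int d dvd case_nat 0 z (Suc i)"
            using d case_mem [OF u(1)] span_u [OF u] unfolding coeffs_dvd_def by blast
          then show "int d dvd z i" by simp
        qed
        ultimately show "d dvd case_nat c n i"
          using below \<open>i < Suc k\<close> by (cases i) auto
      qed
    qed
  qed
  then show ?thesis using that by blast
qed

text \<open>The generators are padded with two copies of the identity, so that the last two orders,
  \<open>n k\<close> and \<open>n (Suc k)\<close>, always exist, even for cyclic or trivial
  groups.\<close>

lemma finitely_generated_diagonal_basis:
  assumes "finitely_generated G"
  obtains b k n where "b \<in> {..<Suc (Suc k)} \<rightarrow> carrier G" "tuple_span (Suc (Suc k)) b = carrier G"
    and "\<And>z. lin_comb (Suc (Suc k)) b z = \<one> \<longleftrightarrow> (\<forall>i<Suc (Suc k). int (n i) dvd z i)"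
    and "\<And>i. i \<le> k \<Longrightarrow> n i dvd n (Suc i)"
proof -
  obtain S where S: "finite S" "S \<subseteq> carrier G" "generate G S = carrier G"
    using assms unfolding finitely_generated_def by blast
  obtain xs where xs: "set xs = S" using S(1) finite_list by blast
  define k a where "k = length xs" and "a i = (if i < k then xs ! i else \<one>)" for i
  have a: "a \<in> {..<Suc (Suc k)} \<rightarrow> carrier G"
    using S(2) xs by (auto simp: a_def k_def subset_iff)
  have "S \<subseteq> tuple_span (Suc (Suc k)) a"
  proof
    fix x assume "x \<in> S"
    then obtain i where "i < k" "x = a i" using xs by (auto simp: a_def k_def in_set_conv_nth)
    then show "x \<in> tuple_span (Suc (Suc k)) a" using tuple_span_mem [OF a, of i] by simp
  qed
  then have "carrier G \<subseteq> tuple_span (Suc (Suc k)) a"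
    using generate_subgroup_incl tuple_span_subgroup [OF a] S(3) by blast
  then have span: "tuple_span (Suc (Suc k)) a = carrier G"
    using tuple_span_subgroup [OF a] subgroup.subset by blast
  obtain b n where "b \<in> {..<Suc (Suc k)} \<rightarrow> carrier G" "tuple_span (Suc (Suc k)) b = tuple_span (Suc (Suc k)) a"
    "\<And>z. lin_comb (Suc (Suc k)) b z = \<one> \<longleftrightarrow> (\<forall>i<Suc (Suc k). int (n i) dvd z i)"
    "\<And>i. Suc i < Suc (Suc k) \<Longrightarrow> n i dvd n (Suc i)"
    using diagonal_basis [OF a] by blast
  with span show ?thesis by (intro that [of b k n]) auto
qed

end

section \<open>Outer commutator words and marginal subgroups\<close>

definition word_vars :: "word \<Rightarrow> nat set" where
  "word_vars w = fst ` set w"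

lemma finite_word_vars [simp]: "finite (word_vars w)"
  by (simp add: word_vars_def)

lemma word_vars_append [simp]: "word_vars (u @ v) = word_vars u \<union> word_vars v"
  by (auto simp: word_vars_def)

lemma word_vars_wvar [simp]: "word_vars (wvar i) = {i}"
  by (simp add: word_vars_def wvar_def)

lemma word_vars_winv [simp]: "word_vars (winv u) = word_vars u"
  by (force simp: word_vars_def winv_def image_image)

lemma word_vars_wcomm [simp]: "word_vars (wcomm u v) = word_vars u \<union> word_vars v"
  by (auto simp: wcomm_def)

lemma word_vars_left_normed_comm: "word_vars (left_normed_comm s k) = {s..s + k}"
  by (induction k) auto

lemma word_value_cong:
  "(\<And>j. j \<in> word_vars w \<Longrightarrow> g j = h j) \<Longrightarrow> word_value E g w = word_value E h w"
  by (induction w) (auto simp: word_vars_def)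

text \<open>Disjointness of the variables puts each variable into exactly one of the two factors, so
  multiplicativity in a variable can be proved by induction on the bracketing.\<close>

inductive outer_commutator :: "word \<Rightarrow> bool" where
  var: "outer_commutator (wvar i)"
| comm: "\<lbrakk>outer_commutator u; outer_commutator v; word_vars u \<inter> word_vars v = {}\<rbrakk> \<Longrightarrow>
    outer_commutator (wcomm u v)"

lemma outer_commutator_left_normed_comm: "outer_commutator (left_normed_comm s k)"
  by (induction k) (auto intro!: outer_commutator.intros simp: word_vars_left_normed_comm)

lemma outer_commutator_outer_comm_word: "outer_commutator (outer_comm_word c1 c2)"
  unfolding outer_comm_word_def
  by (intro outer_commutator.comm outer_commutator_left_normed_comm)
    (auto simp: word_vars_left_normed_comm)

section \<open>Commutator identities and marginal subgroups\<close>

context group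
begin

definition commutator :: "'a \<Rightarrow> 'a \<Rightarrow> 'a" where
  "commutator a b = inv a \<otimes> (inv b \<otimes> (a \<otimes> b))"

lemma commutator_closed [simp]: "a \<in> carrier G \<Longrightarrow> b \<in> carrier G \<Longrightarrow> commutator a b \<in> carrier G"
  by (simp add: commutator_def)

lemma inv_mult_cancel [simp]:
  "x \<in> carrier G \<Longrightarrow> y \<in> carrier G \<Longrightarrow> inv x \<otimes> (x \<otimes> y) = y"
  "x \<in> carrier G \<Longrightarrow> y \<in> carrier G \<Longrightarrow> x \<otimes> (inv x \<otimes> y) = y"
  by (simp_all add: m_assoc [symmetric])

lemma commutator_mult_left:
  assumes "p \<in> carrier G" "q \<in> carrier G" "b \<in> carrier G"
  shows "commutator (p \<otimes> q) b = inv q \<otimes> commutator p b \<otimes> q \<otimes> commutator q b"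
  using assms by (simp add: commutator_def m_assoc inv_mult_group)

text \<open>The usual identity \<open>[a, pq] = [a, q] [a, p]^q\<close>, with the conjugated factor
  brought to the left. Both multiplication rules then read: a conjugate of the first commutator
  times the second.\<close>

lemma commutator_mult_right:
  assumes "a \<in> carrier G" "p \<in> carrier G" "q \<in> carrier G"
  shows "commutator a (p \<otimes> q)
    = inv (q \<otimes> inv (commutator a q)) \<otimes> commutator a p \<otimes> (q \<otimes> inv (commutator a q)) \<otimes> commutator a q"
  using assms by (simp add: commutator_def m_assoc inv_mult_group)

lemma word_value_closed [simp]: "(\<And>j. g j \<in> carrier G) \<Longrightarrow> word_value G g w \<in> carrier G"
  by (induction w) auto

lemma word_value_append:
  "(\<And>j. g j \<in> carrier G) \<Longrightarrow> word_value G g (u @ v) = word_value G g u \<otimes> word_value G g v"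
  by (induction u) (auto simp: m_assoc)

lemma word_value_wvar [simp]: "g i \<in> carrier G \<Longrightarrow> word_value G g (wvar i) = g i"
  by (simp add: wvar_def)

lemma word_value_winv:
  assumes "\<And>j. g j \<in> carrier G"
  shows "word_value G g (winv u) = inv (word_value G g u)"
proof (induction u)
  case Nil
  then show ?case by (simp add: winv_def)
next
  case (Cons l u)
  have "winv (l # u) = winv u @ [(fst l, \<not> snd l)]" by (simp add: winv_def case_prod_beta)
  then show ?case using Cons assms by (simp add: word_value_append inv_mult_group)
qed

lemma word_value_wcomm:
  "(\<And>j. g j \<in> carrier G) \<Longrightarrow>
    word_value G g (wcomm u v) = commutator (word_value G g u) (word_value G g v)"
  by (simp add: wcomm_def word_value_append word_value_winv commutator_def)

lemma word_value_conj:
  assumes "\<And>j. g j \<in> carrier G" "c \<in> carrier G"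
  shows "word_value G (\<lambda>j. inv c \<otimes> g j \<otimes> c) w = inv c \<otimes> word_value G g w \<otimes> c"
  using assms by (induction w) (auto simp: m_assoc inv_mult_group)

lemma word_value_commutes:
  assumes "\<And>j. g j \<in> carrier G" "c \<in> carrier G" "\<And>j. c \<otimes> g j = g j \<otimes> c"
  shows "c \<otimes> word_value G g w = word_value G g w \<otimes> c"
proof -
  have "inv c \<otimes> g j \<otimes> c = g j" for j
    using assms(1,2) assms(3) [of j, symmetric] by (simp add: m_assoc)
  then have "inv c \<otimes> word_value G g w \<otimes> c = word_value G g w"
    using word_value_conj [of g c w] assms by simp
  moreover have "c \<otimes> (inv c \<otimes> word_value G g w \<otimes> c) = word_value G g w \<otimes> c"
    using assms by (simp add: m_assoc)
  ultimately show ?thesis by simp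
qed

text \<open>Words in the single element \<open>e\<close> commute with \<open>e\<close> and hence
  with each other. This is the base case of the exponent argument, where all arguments are
  equal.\<close>

lemma word_value_wcomm_const:
  assumes e: "e \<in> carrier G"
  shows "word_value G (\<lambda>_. e) (wcomm u v) = \<one>"
proof -
  have "e \<otimes> word_value G (\<lambda>_. e) u = word_value G (\<lambda>_. e) u \<otimes> e"
    using e by (intro word_value_commutes) auto
  then have "word_value G (\<lambda>_. e) u \<otimes> word_value G (\<lambda>_. e) v
      = word_value G (\<lambda>_. e) v \<otimes> word_value G (\<lambda>_. e) u"
    using e by (intro word_value_commutes) auto
  then show ?thesis using e by (simp add: word_value_wcomm commutator_def)
qed

lemma marginalD:
  assumes "a \<in> marginal {v} G" "\<And>j. g j \<in> carrier G"
  shows "word_value G (g(i := g i \<otimes> a)) v = word_value G g v"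
  using assms by (auto simp: marginal_def)

lemma marginal_subgroup: "subgroup (marginal {v} G) G"
proof (rule subgroupI)
  show "marginal {v} G \<subseteq> carrier G" by (auto simp: marginal_def)
  have "\<one> \<in> marginal {v} G" by (simp add: marginal_def)
  then show "marginal {v} G \<noteq> {}" by blast
next
  fix a assume a: "a \<in> marginal {v} G"
  then have ac: "a \<in> carrier G" by (simp add: marginal_def)
  have "word_value G (g(i := g i \<otimes> inv a)) v = word_value G g v" if "\<forall>j. g j \<in> carrier G" for g i
    using marginalD [OF a, of "g(i := g i \<otimes> inv a)" i] that ac by (simp add: m_assoc)
  then show "inv a \<in> marginal {v} G" using ac by (auto simp: marginal_def)
next
  fix a b assume a: "a \<in> marginal {v} G" and b: "b \<in> marginal {v} G"
  then have ac: "a \<in> carrier G" "b \<in> carrier G" by (simp_all add: marginal_def)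
  have "word_value G (g(i := g i \<otimes> (a \<otimes> b))) v = word_value G g v" if "\<forall>j. g j \<in> carrier G" for g i
    using marginalD [OF b, of "g(i := g i \<otimes> a)" i] marginalD [OF a, of g i] that ac
    by (simp add: m_assoc)
  then show "a \<otimes> b \<in> marginal {v} G" using ac by (auto simp: marginal_def)
qed

text \<open>Conjugating all arguments by \<open>x\<close> conjugates the value, and it turns the
  extra factor \<open>a\<close> into \<open>x \<otimes> a \<otimes> inv x\<close>.\<close>

lemma marginal_normal: "marginal {v} G \<lhd> G"
  unfolding normal_inv_iff
proof (intro conjI ballI marginal_subgroup)
  fix x a assume x: "x \<in> carrier G" and a: "a \<in> marginal {v} G"
  then have ac: "a \<in> carrier G" by (simp add: marginal_def)
  have "word_value G (g(i := g i \<otimes> (x \<otimes> a \<otimes> inv x))) v = word_value G g v"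
    if g: "\<forall>j. g j \<in> carrier G" for g i
  proof -
    define h where "h j = inv x \<otimes> g j \<otimes> x" for j
    have h: "h j \<in> carrier G" for j using g x by (simp add: h_def)
    have conj: "word_value G (\<lambda>j. x \<otimes> f j \<otimes> inv x) v = x \<otimes> word_value G f v \<otimes> inv x"
      if "\<And>j. f j \<in> carrier G" for f
      using word_value_conj [of f "inv x"] that x by simp
    have "g(i := g i \<otimes> (x \<otimes> a \<otimes> inv x)) = (\<lambda>j. x \<otimes> (h(i := h i \<otimes> a)) j \<otimes> inv x)"
      using g x ac by (auto simp: h_def m_assoc)
    then have "word_value G (g(i := g i \<otimes> (x \<otimes> a \<otimes> inv x))) v
        = x \<otimes> word_value G (h(i := h i \<otimes> a)) v \<otimes> inv x"
      using conj [of "h(i := h i \<otimes> a)"] h ac by simp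
    also have "\<dots> = x \<otimes> word_value G h v \<otimes> inv x" using marginalD [OF a, of h] h by simp
    also have "\<dots> = word_value G (\<lambda>j. x \<otimes> h j \<otimes> inv x) v" using conj [OF h] by simp
    also have "(\<lambda>j. x \<otimes> h j \<otimes> inv x) = g" using g x by (auto simp: h_def m_assoc)
    finally show ?thesis .
  qed
  then show "x \<otimes> a \<otimes> inv x \<in> marginal {v} G" using x ac by (auto simp: marginal_def)
qed

text \<open>The value depends only on the cosets of the arguments: they are exchanged one variable
  at a time, and finitely many variables occur.\<close>

lemma word_value_marginal_cong:
  assumes g: "\<And>j. g j \<in> carrier G" and h: "\<And>j. h j \<in> carrier G"
    and cong: "\<And>j. inv (g j) \<otimes> h j \<in> marginal {v} G"
  shows "word_value G g v = word_value G h v"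
proof -
  have "word_value G (\<lambda>j. if j \<in> J then h j else g j) v = word_value G g v" if "finite J" for J
    using that
  proof (induction J)
    case (insert i J)
    let ?f = "\<lambda>j. if j \<in> J then h j else g j"
    have "(\<lambda>j. if j \<in> insert i J then h j else g j) = ?f(i := ?f i \<otimes> (inv (g i) \<otimes> h i))"
      using insert.hyps g h by auto
    then show ?case using marginalD [OF cong [of i], of ?f i] insert.IH g h by simp
  qed simp
  from this [of "word_vars v"] show ?thesis
    using word_value_cong [of v "\<lambda>j. if j \<in> word_vars v then h j else g j" h G] by simp
qed

end

text \<open>Expanding \<open>[p q, b] = [p, b]\<^sup>q [q, b]\<close> and absorbing the conjugations into the arguments
  makes an outer commutator word exactly multiplicative in each variable.\<close>

lemma outer_commutator_split:
  assumes "outer_commutator w" and E: "group E" and A: "comm_group A" and hom: "\<psi> \<in> hom E A"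
    and "\<And>j. g j \<in> carrier E" "x \<in> carrier E" "y \<in> carrier E" "i \<in> word_vars w"
  shows "\<exists>g' g''. (\<forall>j. g' j \<in> carrier E) \<and> (\<forall>j. g'' j \<in> carrier E)
    \<and> (\<forall>j. \<psi> (g' j) = \<psi> ((g(i := x)) j)) \<and> (\<forall>j. \<psi> (g'' j) = \<psi> ((g(i := y)) j))
    \<and> word_value E (g(i := x \<otimes>\<^bsub>E\<^esub> y)) w = word_value E g' w \<otimes>\<^bsub>E\<^esub> word_value E g'' w"
  using assms(1,5-)
proof (induction w rule: outer_commutator.induct)
  interpret E: group E by fact
  case (var l)
  then show ?case
    by (intro exI [of _ "g(i := x)"] exI [of _ "g(i := y)"]) auto
next
  interpret E: group E by fact
  interpret A: comm_group A by fact
  interpret group_hom E A \<psi> using hom by unfold_locales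
  case (comm u v)
  note g = comm.prems(1) and xy = comm.prems(2,3)
  let ?g = "g(i := x \<otimes>\<^bsub>E\<^esub> y)"
  have gc: "?g j \<in> carrier E" for j using g xy by simp
  \<comment> \<open>The target is abelian, so conjugating the arguments is invisible under
    \<open>\<psi>\<close>.\<close>
  have \<psi>_conj: "\<psi> (inv\<^bsub>E\<^esub> c \<otimes>\<^bsub>E\<^esub> z \<otimes>\<^bsub>E\<^esub> c) = \<psi> z" if "c \<in> carrier E" "z \<in> carrier E" for c z
    using that A.m_comm [of "inv\<^bsub>A\<^esub> \<psi> c" "\<psi> z"] by (simp add: A.m_assoc)
  from comm.prems(4) consider "i \<in> word_vars u" "i \<notin> word_vars v" | "i \<in> word_vars v" "i \<notin> word_vars u"
    using comm.hyps(3) by auto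
  then show ?case
  proof cases
    case 1
    obtain g' g'' where s: "\<And>j. g' j \<in> carrier E" "\<And>j. g'' j \<in> carrier E"
      "\<And>j. \<psi> (g' j) = \<psi> ((g(i := x)) j)" "\<And>j. \<psi> (g'' j) = \<psi> ((g(i := y)) j)"
      "word_value E ?g u = word_value E g' u \<otimes>\<^bsub>E\<^esub> word_value E g'' u"
      using comm.IH(1) [OF g xy 1(1)] by blast
    \<comment> \<open>The two assignments produced for \<open>u\<close> are reset to
      \<open>g\<close> on the variables of \<open>v\<close>; disjointness leaves the values of
      \<open>u\<close> unchanged.\<close>
    define f' f'' where "f' j = (if j \<in> word_vars v then g j else g' j)"
      and "f'' j = (if j \<in> word_vars v then g j else g'' j)" for j
    have f: "\<And>j. f' j \<in> carrier E" "\<And>j. f'' j \<in> carrier E" using s g by (auto simp: f'_def f''_def)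
    have fu: "word_value E f' u = word_value E g' u" "word_value E f'' u = word_value E g'' u"
      using comm.hyps(3) by (auto intro!: word_value_cong simp: f'_def f''_def)
    have fv: "word_value E f' v = word_value E ?g v" "word_value E f'' v = word_value E ?g v"
      using 1(2) by (auto intro!: word_value_cong simp: f'_def f''_def)
    define c where "c = word_value E g'' u"
    have c: "c \<in> carrier E" using s by (simp add: c_def)
    have "word_value E ?g (wcomm u v)
        = inv\<^bsub>E\<^esub> c \<otimes>\<^bsub>E\<^esub> word_value E f' (wcomm u v) \<otimes>\<^bsub>E\<^esub> c \<otimes>\<^bsub>E\<^esub> word_value E f'' (wcomm u v)"
      using E.commutator_mult_left [of "word_value E g' u" "word_value E g'' u" "word_value E ?g v"]
        s f gc fu fv by (simp add: E.word_value_wcomm c_def)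
    also have "inv\<^bsub>E\<^esub> c \<otimes>\<^bsub>E\<^esub> word_value E f' (wcomm u v) \<otimes>\<^bsub>E\<^esub> c
        = word_value E (\<lambda>j. inv\<^bsub>E\<^esub> c \<otimes>\<^bsub>E\<^esub> f' j \<otimes>\<^bsub>E\<^esub> c) (wcomm u v)"
      using E.word_value_conj [of f' c "wcomm u v"] f(1) c by simp
    finally show ?thesis
      using f c s(3,4) 1(2) by (intro exI [of _ "\<lambda>j. inv\<^bsub>E\<^esub> c \<otimes>\<^bsub>E\<^esub> f' j \<otimes>\<^bsub>E\<^esub> c"] exI [of _ f''])
        (auto simp del: hom_mult simp add: \<psi>_conj f'_def f''_def)
  next
    case 2
    obtain g' g'' where s: "\<And>j. g' j \<in> carrier E" "\<And>j. g'' j \<in> carrier E"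
      "\<And>j. \<psi> (g' j) = \<psi> ((g(i := x)) j)" "\<And>j. \<psi> (g'' j) = \<psi> ((g(i := y)) j)"
      "word_value E ?g v = word_value E g' v \<otimes>\<^bsub>E\<^esub> word_value E g'' v"
      using comm.IH(2) [OF g xy 2(1)] by blast
    define f' f'' where "f' j = (if j \<in> word_vars u then g j else g' j)"
      and "f'' j = (if j \<in> word_vars u then g j else g'' j)" for j
    have f: "\<And>j. f' j \<in> carrier E" "\<And>j. f'' j \<in> carrier E" using s g by (auto simp: f'_def f''_def)
    have fv: "word_value E f' v = word_value E g' v" "word_value E f'' v = word_value E g'' v"
      using comm.hyps(3) by (auto intro!: word_value_cong simp: f'_def f''_def)
    have fu: "word_value E f' u = word_value E ?g u" "word_value E f'' u = word_value E ?g u"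
      using 2(2) by (auto intro!: word_value_cong simp: f'_def f''_def)
    \<comment> \<open>The conjugating element prescribed by \<open>commutator_mult_right\<close>;
      the value of \<open>f''\<close> on the whole word is the second commutator.\<close>
    define c where "c = word_value E g'' v \<otimes>\<^bsub>E\<^esub> inv\<^bsub>E\<^esub> (word_value E f'' (wcomm u v))"
    have c: "c \<in> carrier E" using s f by (simp add: c_def)
    have "word_value E ?g (wcomm u v)
        = inv\<^bsub>E\<^esub> c \<otimes>\<^bsub>E\<^esub> word_value E f' (wcomm u v) \<otimes>\<^bsub>E\<^esub> c \<otimes>\<^bsub>E\<^esub> word_value E f'' (wcomm u v)"
      using E.commutator_mult_right [of "word_value E ?g u" "word_value E g' v" "word_value E g'' v"]
        s f gc fu fv by (simp add: E.word_value_wcomm c_def)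
    also have "inv\<^bsub>E\<^esub> c \<otimes>\<^bsub>E\<^esub> word_value E f' (wcomm u v) \<otimes>\<^bsub>E\<^esub> c
        = word_value E (\<lambda>j. inv\<^bsub>E\<^esub> c \<otimes>\<^bsub>E\<^esub> f' j \<otimes>\<^bsub>E\<^esub> c) (wcomm u v)"
      using E.word_value_conj [of f' c "wcomm u v"] f(1) c by simp
    finally show ?thesis
      using f c s(3,4) 2(2) by (intro exI [of _ "\<lambda>j. inv\<^bsub>E\<^esub> c \<otimes>\<^bsub>E\<^esub> f' j \<otimes>\<^bsub>E\<^esub> c"] exI [of _ f''])
        (auto simp del: hom_mult simp add: \<psi>_conj f'_def f''_def)
  qed
qed

lemma (in group) center_eq_marginal: "center G = marginal {outer_comm_word 0 0} G"
proof -
  have val: "word_value G g (outer_comm_word 0 0) = commutator (g 0) (g 1)"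
    if "\<And>j. g j \<in> carrier G" for g
    using that by (simp add: outer_comm_word_def word_value_wcomm)
  show ?thesis
  proof (intro equalityI subsetI)
    fix a assume "a \<in> center G"
    then have a: "a \<in> carrier G" and comm: "\<And>b. b \<in> carrier G \<Longrightarrow> a \<otimes> b = b \<otimes> a"
      by (auto simp: center_def)
    have triv: "commutator a y = \<one>" "commutator y a = \<one>" if "y \<in> carrier G" for y
      using that a by (simp_all add: commutator_def comm [symmetric]) (simp_all add: comm)
    have conj: "inv a \<otimes> y \<otimes> a = y" if "y \<in> carrier G" for y
      using that a by (simp add: m_assoc comm [symmetric])
    have "commutator (x \<otimes> a) y = commutator x y" "commutator y (x \<otimes> a) = commutator y x"
      if "x \<in> carrier G" "y \<in> carrier G" for x y
      using that a by (simp_all add: commutator_mult_left commutator_mult_right triv conj)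
    then show "a \<in> marginal {outer_comm_word 0 0} G"
      using a by (auto simp: marginal_def val)
  next
    fix a assume a: "a \<in> marginal {outer_comm_word 0 0} G"
    then have ac: "a \<in> carrier G" by (simp add: marginal_def)
    have "a \<otimes> b = b \<otimes> a" if "b \<in> carrier G" for b
    proof -
      \<comment> \<open>With first argument 1 the commutator is trivial; multiplying that argument
        by \<open>a\<close> gives \<open>[a, b]\<close>, which must therefore be trivial.\<close>
      define g where "g = (\<lambda>_::nat. \<one>)(1 := b)"
      have g: "g j \<in> carrier G" for j using that by (simp add: g_def)
      have "word_value G (g(0 := g 0 \<otimes> a)) (outer_comm_word 0 0) = commutator a b"
        using val [of "g(0 := g 0 \<otimes> a)"] g ac that by (simp add: g_def)
      moreover have "word_value G g (outer_comm_word 0 0) = \<one>"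
        using val [of g, OF g] that by (simp add: g_def commutator_def)
      ultimately have "commutator a b = \<one>" using marginalD [OF a, of g 0] g by simp
      then have "b \<otimes> (a \<otimes> commutator a b) = b \<otimes> a" using ac that by simp
      then show ?thesis using ac that by (simp add: commutator_def)
    qed
    then show "a \<in> center G" using ac by (simp add: center_def)
  qed
qed

section \<open>Necessity: a marginal quotient has equal last two orders\<close>

lemma (in comm_group) invariants_eq_of_marginal_quotient:
  fixes E :: "('e, 'f) monoid_scheme"
  assumes b: "b \<in> {..<Suc (Suc k)} \<rightarrow> carrier G" and span: "tuple_span (Suc (Suc k)) b = carrier G"
    and rel: "\<And>z. lin_comb (Suc (Suc k)) b z = \<one> \<longleftrightarrow> (\<forall>i<Suc (Suc k). int (n i) dvd z i)"
    and chain: "\<And>i. i \<le> k \<Longrightarrow> n i dvd n (Suc i)"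
    and w: "outer_commutator (wcomm u v)"
    and E: "group E" and iso: "G \<cong> E Mod marginal {wcomm u v} E"
  shows "n (Suc k) = n k"
proof -
  interpret E: group E by fact
  define M where "M = marginal {wcomm u v} E"
  interpret M: normal M E unfolding M_def by (rule E.marginal_normal)
  \<comment> \<open>The isomorphism is inverted in order to view \<open>G\<close> as the image of
    \<open>E\<close> under a homomorphism \<open>\<psi>\<close> whose kernel is the marginal
    subgroup.\<close>
  obtain f where f: "f \<in> iso (E Mod M) G"
    using iso M.factorgroup_is_group iso_sym unfolding M_def is_iso_def by blast
  define \<psi> where "\<psi> = f \<circ> (\<lambda>x. M #>\<^bsub>E\<^esub> x)"
  have \<psi>_hom: "\<psi> \<in> hom E G"
    unfolding \<psi>_def using M.r_coset_hom_Mod f by (intro Group.hom_compose) (auto simp: iso_def)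
  interpret \<psi>: group_hom E G \<psi> using \<psi>_hom by unfold_locales
  have f_bij: "bij_betw f (carrier (E Mod M)) (carrier G)" using f by (simp add: iso_def)
  have surj: "\<psi> ` carrier E = carrier G"
    using f_bij unfolding \<psi>_def bij_betw_def by (auto simp: FactGroup_def RCOSETS_def)
  have coset: "M #>\<^bsub>E\<^esub> x \<in> carrier (E Mod M)" if "x \<in> carrier E" for x
    using that by (auto simp: FactGroup_def RCOSETS_def)
  have \<psi>_inj: "inv\<^bsub>E\<^esub> x \<otimes>\<^bsub>E\<^esub> y \<in> M" if "\<psi> x = \<psi> y" "x \<in> carrier E" "y \<in> carrier E" for x y
  proof -
    have "\<psi> (inv\<^bsub>E\<^esub> x \<otimes>\<^bsub>E\<^esub> y) = \<psi> \<one>\<^bsub>E\<^esub>" using that by simp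
    then have "M #>\<^bsub>E\<^esub> (inv\<^bsub>E\<^esub> x \<otimes>\<^bsub>E\<^esub> y) = M #>\<^bsub>E\<^esub> \<one>\<^bsub>E\<^esub>"
      using f_bij coset [of "inv\<^bsub>E\<^esub> x \<otimes>\<^bsub>E\<^esub> y"] coset [of "\<one>\<^bsub>E\<^esub>"] that
      unfolding \<psi>_def bij_betw_def inj_on_def by simp
    then show ?thesis using E.rcos_self [OF _ M.subgroup_axioms] that M.subset by force
  qed
  have \<psi>_one: "\<psi> x = \<one>" if "x \<in> M" for x
  proof -
    have "M #>\<^bsub>E\<^esub> x = M #>\<^bsub>E\<^esub> \<one>\<^bsub>E\<^esub>"
      using that M.rcos_const E.coset_mult_one [OF M.subset] by simp
    then have "\<psi> x = \<psi> \<one>\<^bsub>E\<^esub>" by (simp add: \<psi>_def)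
    then show ?thesis by simp
  qed
  define val where "val g = word_value E g (wcomm u v)" for g
  have val_closed: "val g \<in> carrier E" if "\<And>j. g j \<in> carrier E" for g
    unfolding val_def using that by simp
  have val_cong: "val g = val h"
    if "\<And>j. g j \<in> carrier E" "\<And>j. h j \<in> carrier E" "\<And>j. \<psi> (g j) = \<psi> (h j)" for g h
    unfolding val_def using that \<psi>_inj unfolding M_def by (intro E.word_value_marginal_cong) auto
  have val_mult: "val (g(i := x \<otimes>\<^bsub>E\<^esub> y)) = val (g(i := x)) \<otimes>\<^bsub>E\<^esub> val (g(i := y))"
    if g: "\<And>j. g j \<in> carrier E" and xy: "x \<in> carrier E" "y \<in> carrier E"
      and i: "i \<in> word_vars (wcomm u v)" for g x y i
  proof -
    obtain g' g'' where "\<forall>j. g' j \<in> carrier E" "\<forall>j. g'' j \<in> carrier E"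
      "\<forall>j. \<psi> (g' j) = \<psi> ((g(i := x)) j)" "\<forall>j. \<psi> (g'' j) = \<psi> ((g(i := y)) j)"
      "val (g(i := x \<otimes>\<^bsub>E\<^esub> y)) = val g' \<otimes>\<^bsub>E\<^esub> val g''"
      using outer_commutator_split [where g = g, OF w E comm_group_axioms \<psi>_hom g xy i]
      unfolding val_def by blast
    moreover from this have "val g' = val (g(i := x))" "val g'' = val (g(i := y))"
      using g xy by (auto intro!: val_cong)
    ultimately show ?thesis by simp
  qed
  have val_hom: "group_hom E E (\<lambda>x. val (g(i := x)))"
    if "\<And>j. g j \<in> carrier E" "i \<in> word_vars (wcomm u v)" for g i
    using that by unfold_locales (auto simp: hom_def val_mult intro!: val_closed)
  obtain e where e: "\<And>l. l < Suc (Suc k) \<Longrightarrow> e l \<in> carrier E"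
    "\<And>l. l < Suc (Suc k) \<Longrightarrow> \<psi> (e l) = b l"
  proof -
    have "\<exists>x. l < Suc (Suc k) \<longrightarrow> x \<in> carrier E \<and> \<psi> x = b l" for l
      using b surj by (metis PiE imageE lessThan_iff)
    then show ?thesis using that by metis
  qed
  define m e' where "m = n k" and "e' = e (Suc k)"
  have e': "e' \<in> carrier E" using e by (simp add: e'_def)
  have b_pow: "b l [^] int m = \<one> \<longleftrightarrow> n l dvd m" if "l < Suc (Suc k)" for l
    using rel [of "\<lambda>j. if j = l then int m else 0"] lin_comb_unit [OF b that, of "int m"] that
    by auto
  have n_chain: "n l dvd n (l + d)" if "l + d \<le> Suc k" for l d
    using that
  proof (induction d)
    case (Suc d)
    then show ?case using chain [of "l + d"] by (auto intro: dvd_trans)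
  qed simp
  have n_dvd: "n l dvd m" if "l \<le> k" for l
    using n_chain [of l "k - l"] that by (simp add: m_def)
  have in_M: "x \<in> M" if "x \<in> carrier E" "\<psi> x = \<one>" for x
    using \<psi>_inj [of "\<one>\<^bsub>E\<^esub>" x] that by simp
  \<comment> \<open>All orders up to index \<open>k\<close> divide \<open>m = n k\<close>; only the
    lift \<open>e'\<close> of the last generator may have a larger order modulo
    \<open>M\<close>.\<close>
  have e_pow: "e l [^]\<^bsub>E\<^esub> m \<in> M" if "l \<le> k" for l
    using that e [of l] b_pow [of l] n_dvd by (intro in_M) (simp_all add: \<psi>.hom_nat_pow int_pow_int)
  have val_M: "val (g(i := x)) = \<one>\<^bsub>E\<^esub>"
    if "\<And>j. g j \<in> carrier E" "i \<in> word_vars (wcomm u v)" "x \<in> M" for g i x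
  proof -
    have "val (g(i := x)) = val (g(i := \<one>\<^bsub>E\<^esub>))"
      using that \<psi>_one M.mem_carrier by (auto intro!: val_cong)
    also have "\<dots> = \<one>\<^bsub>E\<^esub>" using group_hom.hom_one [OF val_hom [of g, OF that(1,2)]] by simp
    finally show ?thesis .
  qed
  \<comment> \<open>Induction on the set \<open>J\<close> of slots with arbitrary arguments; all
    other slots contain \<open>e'\<close>.\<close>
  have pow_eq_one: "val g [^]\<^bsub>E\<^esub> m = \<one>\<^bsub>E\<^esub>"
    if "finite J" "J \<subseteq> word_vars (wcomm u v)" "\<And>j. g j \<in> carrier E" "\<And>j. j \<notin> J \<Longrightarrow> g j = e'" for J g
    using that
  proof (induction J arbitrary: g)
    case empty
    then have "g = (\<lambda>_. e')" by auto
    then show ?case using e' by (simp add: val_def E.word_value_wcomm_const)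
  next
    case (insert i J)
    note g = insert.prems(2)
    have i: "i \<in> word_vars (wcomm u v)" using insert.prems(1) by simp
    interpret h: group_hom E E "\<lambda>x. val (g(i := x))" by (rule val_hom [OF g i])
    \<comment> \<open>The arguments for slot \<open>i\<close> with the desired property. They form a
      subgroup containing lifts of all generators, so up to \<open>M\<close> they exhaust
      \<open>E\<close>.\<close>
    define Y where "Y = {y \<in> carrier E. val (g(i := y)) [^]\<^bsub>E\<^esub> m = \<one>\<^bsub>E\<^esub>}"
    \<comment> \<open>Values differing only in slot \<open>i\<close> commute because
      \<open>\<psi>\<close> does not distinguish \<open>x y\<close> from \<open>y x\<close>. This
      allows the power of a product to be distributed.\<close>
    have comm: "val (g(i := x)) \<otimes>\<^bsub>E\<^esub> val (g(i := y)) = val (g(i := y)) \<otimes>\<^bsub>E\<^esub> val (g(i := x))"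
      if "x \<in> carrier E" "y \<in> carrier E" for x y
    proof -
      have "val (g(i := x \<otimes>\<^bsub>E\<^esub> y)) = val (g(i := y \<otimes>\<^bsub>E\<^esub> x))"
        using that g by (intro val_cong) (auto simp: m_comm)
      then show ?thesis using that by simp
    qed
    have Y: "subgroup Y E"
    proof (rule E.subgroupI)
      show "Y \<subseteq> carrier E" by (auto simp: Y_def)
      have "\<one>\<^bsub>E\<^esub> \<in> Y" by (simp add: Y_def)
      then show "Y \<noteq> {}" by blast
      show "inv\<^bsub>E\<^esub> y \<in> Y" if "y \<in> Y" for y using that by (simp add: Y_def E.nat_pow_inv)
      show "x \<otimes>\<^bsub>E\<^esub> y \<in> Y" if "x \<in> Y" "y \<in> Y" for x y
        using that by (simp add: Y_def E.pow_mult_distrib comm)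
    qed
    \<comment> \<open>For the last generator, slot \<open>i\<close> joins those filled with
      \<open>e'\<close> and the induction hypothesis applies. For the others the exponent moves into
      the argument, which becomes marginal.\<close>
    have e_Y: "e l \<in> Y" if l: "l < Suc (Suc k)" for l
    proof (cases "l = Suc k")
      case True
      have "val (g(i := e')) [^]\<^bsub>E\<^esub> m = \<one>\<^bsub>E\<^esub>"
        using insert.prems g e' by (intro insert.IH) auto
      then show ?thesis using True e' by (simp add: Y_def e'_def)
    next
      case False
      then have "val (g(i := e l [^]\<^bsub>E\<^esub> m)) = \<one>\<^bsub>E\<^esub>" using l e_pow i g by (intro val_M) auto
      then show ?thesis using e l h.hom_nat_pow [of "e l" m] by (simp add: Y_def)
    qed
    have "subgroup (\<psi> ` Y) G" using Y by (rule \<psi>.subgroup_img_is_subgroup)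
    moreover have "b l \<in> \<psi> ` Y" if "l < Suc (Suc k)" for l using e_Y e that by (metis imageI)
    ultimately have "carrier G \<subseteq> \<psi> ` Y"
      unfolding span [symmetric] tuple_span_def using lin_comb_in_subgroup by blast
    then obtain y where y: "y \<in> Y" "\<psi> y = \<psi> (g i)" using g \<psi>.hom_closed by (metis imageE subsetD)
    then have "val g = val (g(i := y))" using g by (intro val_cong) (auto simp: Y_def)
    then show ?case using y by (simp add: Y_def)
  qed
  have pow_eq_one': "val g [^]\<^bsub>E\<^esub> m = \<one>\<^bsub>E\<^esub>" if "\<And>j. g j \<in> carrier E" for g
  proof -
    let ?h = "\<lambda>j. if j \<in> word_vars (wcomm u v) then g j else e'"
    have "val g = val ?h" unfolding val_def by (rule word_value_cong) simp
    then show ?thesis using pow_eq_one [OF finite_word_vars order_refl, of ?h] that e' by simp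
  qed
  \<comment> \<open>Multiplying an argument by the \<open>m\<close>-th power of \<open>e'\<close>
    multiplies the value by an \<open>m\<close>-th power of a value, which is trivial.\<close>
  have "val (g(i := g i \<otimes>\<^bsub>E\<^esub> e' [^]\<^bsub>E\<^esub> m)) = val g" if "\<forall>j. g j \<in> carrier E" for g i
  proof (cases "i \<in> word_vars (wcomm u v)")
    case True
    have g: "\<And>j. g j \<in> carrier E" using that by blast
    interpret h: group_hom E E "\<lambda>x. val (g(i := x))" by (rule val_hom [OF g True])
    show ?thesis
      using h.hom_nat_pow [OF e', of m] pow_eq_one' [of "g(i := e')"] g e' val_closed [of g] by simp
  next
    case False
    show ?thesis unfolding val_def by (rule word_value_cong) (use False in auto)
  qed
  then have "e' [^]\<^bsub>E\<^esub> m \<in> M"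
    unfolding M_def marginal_def val_def using E.nat_pow_closed [OF e'] by blast
  then have "b (Suc k) [^] m = \<one>"
    using \<psi>_one [of "e' [^]\<^bsub>E\<^esub> m"] \<psi>.hom_nat_pow [OF e'] e(2) [of "Suc k"] by (simp add: e'_def)
  then have "n (Suc k) dvd n k" using b_pow [of "Suc k"] by (simp add: int_pow_int m_def)
  then show ?thesis using chain [of k] by (simp add: dvd_antisym)
qed

section \<open>Groups of noncommutative power series\<close>

lemma word_value_hom:
  assumes "group E" "group F" "h \<in> hom E F" "\<And>j. g j \<in> carrier E"
  shows "h (word_value E g w) = word_value F (h \<circ> g) w"
proof -
  interpret E: group E by fact
  interpret group_hom E F h using assms by (simp add: group_hom_def group_hom_axioms_def)
  show ?thesis using assms(4) by (induction w) auto
qed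

text \<open>The witness is the quotient of \<open>S\<close> by the congruence with the same fibres
  as \<open>\<rho>\<close>, realized on the codes \<open>\<rho> x\<close> of type \<open>'b\<close>.
  The last assumption says that the kernel of \<open>\<theta>\<close> consists of the elements that
  are marginal up to this congruence, so the first isomorphism theorem applies.\<close>

lemma variety_capableI:
  fixes S :: "('s, 't) monoid_scheme" and \<rho> :: "'s \<Rightarrow> 'b"
  assumes S: "group S" and G: "group G"
    and congr: "\<And>x x' y y'. \<lbrakk>x \<in> carrier S; x' \<in> carrier S; y \<in> carrier S; y' \<in> carrier S;
        \<rho> x = \<rho> x'; \<rho> y = \<rho> y'\<rbrakk> \<Longrightarrow> \<rho> (x \<otimes>\<^bsub>S\<^esub> y) = \<rho> (x' \<otimes>\<^bsub>S\<^esub> y')"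
    and \<theta>: "\<theta> \<in> hom S G" "\<theta> ` carrier S = carrier G"
    and \<theta>_congr: "\<And>x y. \<lbrakk>x \<in> carrier S; y \<in> carrier S; \<rho> x = \<rho> y\<rbrakk> \<Longrightarrow> \<theta> x = \<theta> y"
    and marginal: "\<And>s. s \<in> carrier S \<Longrightarrow> \<theta> s = \<one>\<^bsub>G\<^esub> \<longleftrightarrow> (\<forall>g i. (\<forall>j. g j \<in> carrier S) \<longrightarrow>
        \<rho> (word_value S (g(i := g i \<otimes>\<^bsub>S\<^esub> s)) v) = \<rho> (word_value S g v))"
  shows "variety_capable TYPE('b) {v} G"
proof -
  interpret S: group S by fact
  interpret G: group G by fact
  define r where "r = inv_into (carrier S) \<rho>"
  have r: "r a \<in> carrier S" "\<rho> (r a) = a" if "a \<in> \<rho> ` carrier S" for a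
    using that by (simp_all add: r_def inv_into_into f_inv_into_f)
  define E :: "'b monoid" where
    "E = \<lparr>carrier = \<rho> ` carrier S, monoid.mult = \<lambda>a b. \<rho> (r a \<otimes>\<^bsub>S\<^esub> r b), one = \<rho> \<one>\<^bsub>S\<^esub>\<rparr>"
  have E_sel: "carrier E = \<rho> ` carrier S" "\<one>\<^bsub>E\<^esub> = \<rho> \<one>\<^bsub>S\<^esub>" "\<And>a b. a \<otimes>\<^bsub>E\<^esub> b = \<rho> (r a \<otimes>\<^bsub>S\<^esub> r b)"
    by (simp_all add: E_def)
  have mult: "\<rho> x \<otimes>\<^bsub>E\<^esub> \<rho> y = \<rho> (x \<otimes>\<^bsub>S\<^esub> y)" if "x \<in> carrier S" "y \<in> carrier S" for x y
    unfolding E_sel using that r by (intro congr) auto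
  have \<rho>: "\<rho> \<in> hom S E" using mult by (auto simp: hom_def E_sel)
  have "group (E\<lparr>carrier := \<rho> ` carrier S, one := \<rho> \<one>\<^bsub>S\<^esub>\<rparr>)"
    by (rule S.hom_imp_img_group [OF \<rho>])
  then have E: "group E" by (simp add: E_def)
  interpret E: group E by (rule E)
  have \<theta>r: "\<theta> (r (\<rho> x)) = \<theta> x" if "x \<in> carrier S" for x
    using that r [of "\<rho> x"] by (intro \<theta>_congr) auto
  have \<theta>r_hom: "(\<lambda>a. \<theta> (r a)) \<in> hom E G"
  proof (rule homI)
    fix a b assume ab: "a \<in> carrier E" "b \<in> carrier E"
    show "\<theta> (r a) \<in> carrier G" using ab \<theta>(1) r by (simp add: E_sel hom_def Pi_def)
    show "\<theta> (r (a \<otimes>\<^bsub>E\<^esub> b)) = \<theta> (r a) \<otimes>\<^bsub>G\<^esub> \<theta> (r b)"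
      using ab \<theta>(1) r \<theta>r by (simp add: E_sel hom_mult)
  qed
  interpret \<theta>r: group_hom E G "\<lambda>a. \<theta> (r a)" using \<theta>r_hom by unfold_locales
  have val: "\<rho> (word_value S g v) = word_value E (\<rho> \<circ> g) v" if "\<And>j. g j \<in> carrier S" for g
    using word_value_hom [OF S E \<rho> that] by simp
  have "marginal {v} E = kernel E G (\<lambda>a. \<theta> (r a))"
  proof (intro equalityI subsetI)
    fix a assume a: "a \<in> marginal {v} E"
    then have ac: "a \<in> \<rho> ` carrier S" by (simp add: marginal_def E_sel)
    have "\<rho> (word_value S (g(i := g i \<otimes>\<^bsub>S\<^esub> r a)) v) = \<rho> (word_value S g v)"
      if g: "\<forall>j. g j \<in> carrier S" for g i
    proof -
      have *: "\<rho> \<circ> g(i := g i \<otimes>\<^bsub>S\<^esub> r a) = (\<rho> \<circ> g)(i := (\<rho> \<circ> g) i \<otimes>\<^bsub>E\<^esub> a)"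
        using g r [OF ac] mult [of "g i" "r a"] by auto
      have "word_value E (\<rho> \<circ> g(i := g i \<otimes>\<^bsub>S\<^esub> r a)) v = word_value E (\<rho> \<circ> g) v"
        unfolding * using g by (intro E.marginalD [OF a]) (auto simp: E_sel)
      then show ?thesis using val [of g] val [of "g(i := g i \<otimes>\<^bsub>S\<^esub> r a)"] g r(1) [OF ac] by simp
    qed
    then have "\<theta> (r a) = \<one>\<^bsub>G\<^esub>" using marginal [OF r(1) [OF ac]] by blast
    then show "a \<in> kernel E G (\<lambda>a. \<theta> (r a))" using ac by (simp add: kernel_def E_sel)
  next
    fix a assume "a \<in> kernel E G (\<lambda>a. \<theta> (r a))"
    then have ac: "a \<in> \<rho> ` carrier S" and "\<theta> (r a) = \<one>\<^bsub>G\<^esub>" by (simp_all add: kernel_def E_sel)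
    then have m: "\<rho> (word_value S (g(i := g i \<otimes>\<^bsub>S\<^esub> r a)) v) = \<rho> (word_value S g v)"
      if "\<forall>j. g j \<in> carrier S" for g i
      using marginal [OF r(1) [OF ac]] that by blast
    have "word_value E (h(i := h i \<otimes>\<^bsub>E\<^esub> a)) v = word_value E h v"
      if h: "\<forall>j. h j \<in> carrier E" for h i
    proof -
      define g where "g = r \<circ> h"
      have g: "g j \<in> carrier S" "\<rho> (g j) = h j" for j using h r [of "h j"] by (simp_all add: g_def E_sel)
      have *: "\<rho> \<circ> g(i := g i \<otimes>\<^bsub>S\<^esub> r a) = h(i := h i \<otimes>\<^bsub>E\<^esub> a)" "\<rho> \<circ> g = h"
        using g r [OF ac] mult [of "g i" "r a"] by auto
      show ?thesis
        using val [of g] val [of "g(i := g i \<otimes>\<^bsub>S\<^esub> r a)"] m [of g i] g(1) r(1) [OF ac] unfolding * by simp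
    qed
    then show "a \<in> marginal {v} E" using ac by (simp add: marginal_def E_sel)
  qed
  moreover have "(\<lambda>a. \<theta> (r a)) ` carrier E = carrier G"
    unfolding E_sel image_image using \<theta>(2) \<theta>r by auto
  ultimately have "E Mod marginal {v} E \<cong> G" using \<theta>r.FactGroup_iso by simp
  moreover have "group (E Mod marginal {v} E)"
    by (rule normal.factorgroup_is_group [OF E.marginal_normal])
  ultimately have "G \<cong> E Mod marginal {v} E" by (simp add: group.iso_sym)
  then show ?thesis using E unfolding variety_capable_def by blast
qed

text \<open>The product of integral power series in noncommuting variables: a list of letters is a
  monomial, and a series is its coefficient function.\<close>

definition conv :: "(nat list \<Rightarrow> int) \<Rightarrow> (nat list \<Rightarrow> int) \<Rightarrow> nat list \<Rightarrow> int" where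
  "conv f g w = (\<Sum>i\<le>length w. f (take i w) * g (drop i w))"

lemma conv_Nil [simp]: "conv f g [] = f [] * g []"
  by (simp add: conv_def)

lemma conv_Cons: "conv f g (x # w) = f [] * g (x # w) + conv (\<lambda>u. f (x # u)) g w"
  by (simp add: conv_def sum.atMost_Suc_shift del: sum.atMost_Suc)

lemma conv_add_left: "conv (\<lambda>w. f w + g w) h w = conv f h w + conv g h w"
  by (simp add: conv_def distrib_right sum.distrib)

lemma conv_add_right: "conv h (\<lambda>w. f w + g w) w = conv h f w + conv h g w"
  by (simp add: conv_def distrib_left sum.distrib)

lemma conv_mult_left: "conv (\<lambda>w. c * f w) h w = c * conv f h w"
  by (simp add: conv_def sum_distrib_left mult.assoc)

text \<open>The induction needs arbitrary \<open>f\<close>, since removing the first letter replaces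
  \<open>f\<close> by its shift \<open>\<lambda>u. f (x # u)\<close>.\<close>

lemma conv_assoc: "conv (conv f g) h w = conv f (conv g h) w"
proof (induction w arbitrary: f)
  case (Cons x w)
  have "conv (conv f g) h (x # w) = f [] * g [] * h (x # w)
      + conv (\<lambda>u. f [] * g (x # u) + conv (\<lambda>u. f (x # u)) g u) h w"
    by (simp add: conv_Cons)
  also have "\<dots> = conv f (conv g h) (x # w)"
    unfolding conv_add_left conv_mult_left Cons.IH
    by (simp add: conv_Cons distrib_left conv_mult_left [of _ "\<lambda>u. g (x # u)"])
  finally show ?case .
qed simp

definition unit_series :: "nat list \<Rightarrow> int" where
  "unit_series w = of_bool (w = [])"

lemma conv_zero_left: "(\<And>u. f u = 0) \<Longrightarrow> conv f g w = 0"
  by (simp add: conv_def)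

lemma conv_unit_left [simp]: "conv unit_series f = f"
proof
  show "conv unit_series f w = f w" for w
    by (cases w) (simp_all add: conv_Cons unit_series_def conv_zero_left)
qed

lemma conv_unit_right [simp]: "conv f unit_series = f"
proof
  show "conv f unit_series w = f w" for w
    by (induction w arbitrary: f) (simp_all add: conv_Cons unit_series_def)
qed

text \<open>Solves \<open>conv f g = unit_series\<close> for \<open>g\<close> coefficient by
  coefficient when \<open>f\<close> has constant term 1.\<close>

fun series_inv :: "(nat list \<Rightarrow> int) \<Rightarrow> nat list \<Rightarrow> int" where
  "series_inv f [] = 1"
| "series_inv f (x # w) = - (\<Sum>i\<le>length w. f (x # take i w) * series_inv f (drop i w))"

lemma conv_series_inv: "f [] = 1 \<Longrightarrow> conv f (series_inv f) = unit_series"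
proof
  show "conv f (series_inv f) w = unit_series w" if "f [] = 1" for w
    using that by (cases w) (simp_all add: conv_Cons unit_series_def, simp add: conv_def)
qed

definition series_group :: "(nat list \<Rightarrow> int) monoid" where
  "series_group = \<lparr>carrier = {f. f [] = 1}, monoid.mult = conv, one = unit_series\<rparr>"

lemma series_group_sel [simp]:
  "carrier series_group = {f. f [] = 1}" "monoid.mult series_group = conv" "one series_group = unit_series"
  by (simp_all add: series_group_def)

lemma unit_series_Nil [simp]: "unit_series [] = 1"
  by (simp add: unit_series_def)

lemma group_series_group: "group series_group"
proof (rule groupI)
  fix f assume "f \<in> carrier series_group"
  then have f: "f [] = 1" by simp
  define g where "g = series_inv f"
  have g: "g [] = 1" by (simp add: g_def)
  have fg: "conv f g = unit_series" unfolding g_def by (rule conv_series_inv [of f, OF f])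
  \<comment> \<open>The right inverse \<open>g\<close> has a right inverse of its own, which must be
    \<open>f\<close>; hence \<open>g\<close> is also a left inverse.\<close>
  have "f = conv f (conv g (series_inv g))" by (simp add: conv_series_inv [of g, OF g])
  also have "\<dots> = series_inv g" by (simp add: conv_assoc [symmetric, abs_def] fg)
  finally have "conv g f = unit_series" using conv_series_inv [of g, OF g] by simp
  then show "\<exists>h\<in>carrier series_group. h \<otimes>\<^bsub>series_group\<^esub> f = \<one>\<^bsub>series_group\<^esub>"
    using g by auto
qed (auto simp: conv_assoc)

section \<open>Lowest-degree terms of group commutators\<close>

definition leading :: "nat \<Rightarrow> (nat list \<Rightarrow> int) \<Rightarrow> (nat list \<Rightarrow> int) \<Rightarrow> bool" where
  "leading p a A \<longleftrightarrow> a [] = 1 \<and> (\<forall>w. w \<noteq> [] \<longrightarrow> length w < p \<longrightarrow> a w = 0)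
    \<and> (\<forall>w. length w = p \<longrightarrow> a w = A w)"

text \<open>The bracket \<open>AB - BA\<close> of homogeneous polynomials of degrees
  \<open>p\<close> and \<open>q\<close>: a monomial of degree \<open>p + q\<close> splits in just
  one way for each product.\<close>

definition lie_bracket ::
    "nat \<Rightarrow> nat \<Rightarrow> (nat list \<Rightarrow> int) \<Rightarrow> (nat list \<Rightarrow> int) \<Rightarrow> nat list \<Rightarrow> int" where
  "lie_bracket p q A B w = A (take p w) * B (drop p w) - B (take q w) * A (drop q w)"

lemma conv_zero_right: "(\<And>u. length u \<le> length w \<Longrightarrow> g u = 0) \<Longrightarrow> conv f g w = 0"
  by (simp add: conv_def)

text \<open>A factor with constant term 1 does not affect the lowest-degree part of a
  product.\<close>

lemma conv_cancel_low:
  assumes "x [] = 1" and D: "\<And>w. length w \<le> m \<Longrightarrow> conv x y w = D w"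
    and zero: "\<And>w. length w < m \<Longrightarrow> D w = 0" and "length w \<le> m"
  shows "y w = D w"
  using assms(4)
proof (induction w rule: length_induct)
  case (1 w)
  show ?case
  proof (cases w)
    case Nil
    then show ?thesis using D [of "[]"] assms(1) by simp
  next
    case (Cons l w')
    have "conv (\<lambda>u. x (l # u)) y w' = 0"
      using 1 zero Cons by (intro conv_zero_right) force
    then show ?thesis using D [of w] 1(2) assms(1) Cons by (simp add: conv_Cons)
  qed
qed

lemma conv_low_degree:
  assumes "\<And>u. length u < p \<Longrightarrow> \<alpha> u = 0" "\<And>u. length u < q \<Longrightarrow> \<beta> u = 0" "length w \<le> p + q"
  shows "conv \<alpha> \<beta> w = (if length w = p + q then \<alpha> (take p w) * \<beta> (drop p w) else 0)"
proof -
  have "conv \<alpha> \<beta> w = (\<Sum>i\<le>length w. if i = p then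
      (if length w = p + q then \<alpha> (take p w) * \<beta> (drop p w) else 0) else 0)"
    unfolding conv_def
  proof (rule sum.cong [OF refl])
    fix i assume i: "i \<in> {..length w}"
    consider "i < p" | "p < i" | "i = p" "length w < p + q" | "i = p" "length w = p + q"
      using assms(3) by linarith
    then show "\<alpha> (take i w) * \<beta> (drop i w) = (if i = p then
      (if length w = p + q then \<alpha> (take p w) * \<beta> (drop p w) else 0) else 0)"
    proof cases
      case 1
      then show ?thesis using assms(1) [of "take i w"] i by simp
    next
      case 2
      then show ?thesis using assms(2) [of "drop i w"] assms(3) i by simp
    next
      case 3
      then have "length (drop i w) < q" using i by auto
      then show ?thesis using assms(2) [of "drop i w"] 3 by simp
    qed simp
  qed
  then show ?thesis by auto
qed

lemma leading_commutator:
  assumes a: "leading p a A" and b: "leading q b B" and pq: "1 \<le> p" "1 \<le> q"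
  shows "leading (p + q) (group.commutator series_group a b) (lie_bracket p q A B)"
proof -
  interpret S: group series_group by (rule group_series_group)
  define c where "c = S.commutator a b"
  have ab: "a [] = 1" "b [] = 1" using a b by (simp_all add: leading_def)
  then have ab_mem: "a \<in> carrier series_group" "b \<in> carrier series_group" by simp_all
  have c_Nil: "c [] = 1" using S.commutator_closed [of a b] ab by (simp add: c_def)
  have "(b \<otimes>\<^bsub>series_group\<^esub> a) \<otimes>\<^bsub>series_group\<^esub> c = a \<otimes>\<^bsub>series_group\<^esub> b"
    unfolding c_def S.commutator_def using ab_mem by (simp del: series_group_sel add: S.m_assoc)
  then have bac: "conv (conv b a) c = conv a b" by simp
  \<comment> \<open>From \<open>b a c = a b\<close> follows \<open>b a (c - 1) = a b - b a\<close>.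
    Writing \<open>a\<close> and \<open>b\<close> as 1 plus terms of degree at least
    \<open>p\<close> and \<open>q\<close>, everything but the commutator of these terms
    cancels.\<close>
  define \<alpha> \<beta> where "\<alpha> w = a w - unit_series w" and "\<beta> w = b w - unit_series w" for w
  have \<alpha>: "\<alpha> u = 0" if "length u < p" for u
    using a that by (cases "u = []") (auto simp: \<alpha>_def leading_def unit_series_def)
  have \<beta>: "\<beta> u = 0" if "length u < q" for u
    using b that by (cases "u = []") (auto simp: \<beta>_def leading_def unit_series_def)
  have \<alpha>_top: "\<alpha> u = A u" if "length u = p" for u
    using a that pq by (auto simp: \<alpha>_def leading_def unit_series_def)
  have \<beta>_top: "\<beta> u = B u" if "length u = q" for u
    using b that pq by (auto simp: \<beta>_def leading_def unit_series_def)
  define D where "D w = conv \<alpha> \<beta> w - conv \<beta> \<alpha> w" for w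
  have expand: "conv (\<lambda>w. \<alpha> w + unit_series w) (\<lambda>w. \<beta> w + unit_series w) w
      = conv \<alpha> \<beta> w + \<alpha> w + \<beta> w + unit_series w" for \<alpha> \<beta> w
    by (simp add: conv_add_left conv_add_right)
  have "conv a b w - conv b a w = D w" for w
    using expand [of \<alpha> \<beta> w] expand [of \<beta> \<alpha> w] by (simp add: \<alpha>_def \<beta>_def D_def)
  moreover have "conv (conv b a) (\<lambda>w. c w - unit_series w) w = conv a b w - conv b a w" for w
    using conv_add_right [of "conv b a" "\<lambda>w. c w - unit_series w" unit_series w] bac by simp
  ultimately have conv_D: "conv (conv b a) (\<lambda>w. c w - unit_series w) w = D w" for w by simp
  have D: "D w = (if length w = p + q then lie_bracket p q A B w else 0)" if "length w \<le> p + q" for w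
    using that conv_low_degree [of p \<alpha> q \<beta> w, OF \<alpha> \<beta>] conv_low_degree [of q \<beta> p \<alpha> w, OF \<beta> \<alpha>]
      \<alpha>_top \<beta>_top by (auto simp: D_def lie_bracket_def add.commute)
  have low: "c w - unit_series w = D w" if "length w \<le> p + q" for w
    using conv_cancel_low [of "conv b a" "p + q" "\<lambda>w. c w - unit_series w" D w] conv_D D ab that by simp
  have c_eq: "c w = (if length w = p + q then lie_bracket p q A B w else 0)"
    if "length w \<le> p + q" "w \<noteq> []" for w
    using low [of w] D [of w] that by (simp add: unit_series_def)
  have "c w = lie_bracket p q A B w" if "length w = p + q" for w
    using c_eq [of w] that pq by (cases "w = []") simp_all
  then show ?thesis using c_Nil c_eq unfolding leading_def c_def [symmetric] by simp
qed

section \<open>Lie polynomials of the commutator words and some of their coefficients\<close>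

primrec lie_left_normed :: "(nat \<Rightarrow> nat list \<Rightarrow> int) \<Rightarrow> nat \<Rightarrow> nat \<Rightarrow> nat list \<Rightarrow> int" where
  "lie_left_normed g s 0 = g s"
| "lie_left_normed g s (Suc k) = lie_bracket (Suc k) 1 (lie_left_normed g s k) (g (s + Suc k))"

definition lie_outer :: "(nat \<Rightarrow> nat list \<Rightarrow> int) \<Rightarrow> nat \<Rightarrow> nat \<Rightarrow> nat list \<Rightarrow> int" where
  "lie_outer g c1 c2 = lie_bracket (Suc c1) (Suc c2) (lie_left_normed g 0 c1) (lie_left_normed g (Suc c1) c2)"

lemma leading_left_normed_comm:
  assumes "\<And>j. g j [] = 1"
  shows "leading (Suc k) (word_value series_group g (left_normed_comm s k)) (lie_left_normed g s k)"
proof (induction k)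
  interpret S: group series_group by (rule group_series_group)
  case 0
  then show ?case using assms by (auto simp: leading_def)
next
  interpret S: group series_group by (rule group_series_group)
  case (Suc k)
  have "leading 1 (g (s + Suc k)) (g (s + Suc k))" using assms by (auto simp: leading_def)
  from leading_commutator [OF Suc this] show ?case
    using assms by (simp add: S.word_value_wcomm)
qed

lemma leading_outer_comm_word:
  assumes "\<And>j. g j [] = 1"
  shows "leading (c1 + c2 + 2) (word_value series_group g (outer_comm_word c1 c2)) (lie_outer g c1 c2)"
proof -
  interpret S: group series_group by (rule group_series_group)
  have "leading (Suc c1 + Suc c2) (word_value series_group g (outer_comm_word c1 c2)) (lie_outer g c1 c2)"
    unfolding outer_comm_word_def lie_outer_def
    using leading_commutator [OF leading_left_normed_comm leading_left_normed_comm, of g g c1 c2] assms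
    by (simp add: S.word_value_wcomm)
  then show ?thesis by simp
qed

lemma lie_left_normed_cong:
  assumes "\<And>j w. length w = 1 \<Longrightarrow> g j w = h j w" "length w = Suc k"
  shows "lie_left_normed g s k w = lie_left_normed h s k w"
  using assms(2) by (induction k arbitrary: w) (simp_all add: assms(1) lie_bracket_def)

lemma lie_outer_cong:
  assumes "\<And>j w. length w = 1 \<Longrightarrow> g j w = h j w" "length w = c1 + c2 + 2"
  shows "lie_outer g c1 c2 w = lie_outer h c1 c2 w"
  using assms by (simp add: lie_outer_def lie_bracket_def lie_left_normed_cong [of g h])

text \<open>In each bracket the subtracted product would need the letter \<open>x\<close> from the
  newest argument, where its coefficient is 0.\<close>

lemma lie_left_normed_coeff:
  assumes "\<And>j. \<lbrakk>s < j; j \<le> s + k\<rbrakk> \<Longrightarrow> g j [x] = 0 \<and> g j [y] = 1"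
  shows "lie_left_normed g s k (x # replicate k y) = g s [x]"
  using assms
proof (induction k)
  case (Suc k)
  have "take k (replicate k y @ [y]) = replicate k y" by simp
  then show ?case using Suc by (simp add: lie_bracket_def replicate_append_same [symmetric])
qed simp

lemma lie_left_normed_coeff_replicate:
  assumes "g (s + Suc k) [y] = 0"
  shows "lie_left_normed g s (Suc k) (replicate (Suc (Suc k)) y) = 0"
proof -
  have "drop (Suc k) (replicate (Suc (Suc k)) y) = [y]" by (simp add: drop_replicate del: replicate_Suc) simp
  then show ?thesis using assms by (simp add: lie_bracket_def)
qed

text \<open>Only the product starting with the last argument can contribute, and it needs a pure
  power of \<open>y\<close> from a shorter bracket. That coefficient vanishes if the bracket has
  weight at least 2; for \<open>k = 1\<close> it is the coefficient of \<open>y\<close> in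
  \<open>g s\<close>, which is unrestricted.\<close>

lemma lie_left_normed_coeff_zero:
  assumes "\<And>j. \<lbrakk>s < j; j \<le> s + k\<rbrakk> \<Longrightarrow> g j [y] = 0" "g s [x] = 0" "k \<noteq> 1"
  shows "lie_left_normed g s k (x # replicate k y) = 0"
proof (cases k)
  case 0
  then show ?thesis using assms by simp
next
  case (Suc l)
  then obtain m where k: "k = Suc (Suc m)" using assms(3) by (cases l) auto
  have "drop (Suc m) (replicate (Suc (Suc m)) y) = [y]" by (simp add: drop_replicate del: replicate_Suc) simp
  then have "lie_left_normed g s k (x # replicate k y)
      = - (g (s + k) [x] * lie_left_normed g s (Suc m) (replicate (Suc (Suc m)) y))"
    using assms(1) [of "s + k"] by (simp add: k lie_bracket_def)
  moreover have "lie_left_normed g s (Suc m) (replicate (Suc (Suc m)) y) = 0"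
    using assms(1) [of "s + Suc m"] by (intro lie_left_normed_coeff_replicate) (simp add: k)
  ultimately show ?thesis by simp
qed

text \<open>For \<open>g = (a, Y, \<dots>, Y; Y, X, \<dots>, X)\<close> the product of the two brackets in the other order does not
  contain the monomial \<open>X Y\<^bsup>c1+1\<^esup> X\<^bsup>c2\<^esup>\<close>: its prefix \<open>X Y\<^bsup>c2\<^esup>\<close> of length \<open>c2 + 1\<close>
  would have to contain \<open>Y\<close> exactly once.\<close>

lemma lie_outer_coeff:
  assumes "c2 \<le> c1" "c2 \<noteq> 1"
    and "\<And>j. \<lbrakk>0 < j; j \<le> Suc c1\<rbrakk> \<Longrightarrow> g j [x] = 0 \<and> g j [y] = 1"
    and "\<And>j. \<lbrakk>Suc c1 < j; j \<le> Suc c1 + c2\<rbrakk> \<Longrightarrow> g j [x] = 1 \<and> g j [y] = 0"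
  shows "lie_outer g c1 c2 (x # replicate (Suc c1) y @ replicate c2 x) = g 0 [x]"
proof -
  let ?w = "x # replicate (Suc c1) y @ replicate c2 x"
  \<comment> \<open>The last \<open>y\<close> of the block opens the second factor: the monomial is
    read as \<open>(x y^c1) (y x^c2)\<close>.\<close>
  have "replicate (Suc c1) y = replicate c1 y @ [y]" by (simp add: replicate_append_same)
  then have "take (Suc c1) ?w = x # replicate c1 y" "drop (Suc c1) ?w = y # replicate c2 x"
    by simp_all
  moreover have "take (Suc c2) ?w = x # replicate c2 y"
    using assms(1) by (simp add: min_def del: replicate_Suc)
  moreover have "lie_left_normed g 0 c1 (x # replicate c1 y) = g 0 [x]"
    using assms(3) by (intro lie_left_normed_coeff) auto
  moreover have "lie_left_normed g (Suc c1) c2 (y # replicate c2 x) = 1"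
    using assms(3,4) by (subst lie_left_normed_coeff) auto
  moreover have "lie_left_normed g (Suc c1) c2 (x # replicate c2 y) = 0"
    using assms(2-4) by (intro lie_left_normed_coeff_zero) auto
  ultimately show ?thesis unfolding lie_outer_def lie_bracket_def by simp
qed

text \<open>The witness is the group of integral power series in noncommuting variables with constant
  term 1, where the coefficient of a monomial of degree at most \<open>c1 + c2 + 2\<close> is taken modulo the
  greatest common divisor of the orders belonging to its letters, and higher monomials are dropped.\<close>

lemma (in comm_group) variety_capable_of_invariants_eq:
  assumes inf: "infinite (UNIV :: 'e set)" and c: "c2 \<le> c1" "c2 \<noteq> 1"
    and b: "b \<in> {..<Suc (Suc k)} \<rightarrow> carrier G" and span: "tuple_span (Suc (Suc k)) b = carrier G"
    and rel: "\<And>z. lin_comb (Suc (Suc k)) b z = \<one> \<longleftrightarrow> (\<forall>i<Suc (Suc k). int (n i) dvd z i)"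
    and chain: "\<And>i. i \<le> k \<Longrightarrow> n i dvd n (Suc i)" and eq: "n (Suc k) = n k"
  shows "variety_capable TYPE('e) {outer_comm_word c1 c2} G"
proof -
  interpret S: group series_group by (rule group_series_group)
  define K N where "K = Suc (Suc k)" and "N = c1 + c2 + 2"
  \<comment> \<open>Modulus 1 discards a coefficient and modulus 0 keeps it exactly. The empty word
    has modulus 0, the gcd of the empty set.\<close>
  define \<mu> where "\<mu> w = (if length w \<le> N \<and> set w \<subseteq> {..<K} then Gcd (n ` set w) else 1)" for w :: "nat list"
  have \<mu>_dvd: "\<mu> w dvd \<mu> u" if "set u \<subseteq> set w" "length u \<le> length w" for u w
  proof (cases "length w \<le> N \<and> set w \<subseteq> {..<K}")
    case True
    have "Gcd (n ` set w) dvd Gcd (n ` set u)"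
      using that(1) by (auto intro!: Gcd_greatest intro: Gcd_dvd)
    then show ?thesis using that True by (auto simp: \<mu>_def)
  qed (auto simp: \<mu>_def)
  define eqv where "eqv f g \<longleftrightarrow> (\<forall>w. int (\<mu> w) dvd f w - g w)" for f g :: "nat list \<Rightarrow> int"
  have eqv_conv: "eqv (conv f g) (conv f' g')" if "eqv f f'" "eqv g g'" for f f' g g'
    unfolding eqv_def
  proof
    fix w
    have "conv f g w - conv f' g' w
        = (\<Sum>i\<le>length w. f (take i w) * (g (drop i w) - g' (drop i w))
            + (f (take i w) - f' (take i w)) * g' (drop i w))"
      unfolding conv_def sum_subtractf [symmetric] by (intro sum.cong refl) (simp add: algebra_simps)
    also have "int (\<mu> w) dvd \<dots>"
    proof (intro dvd_sum dvd_add)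
      fix i
      have "int (\<mu> w) dvd int (\<mu> (drop i w))" "int (\<mu> w) dvd int (\<mu> (take i w))"
        using \<mu>_dvd [of "drop i w" w] \<mu>_dvd [of "take i w" w]
        by (simp_all add: set_drop_subset set_take_subset)
      then show "int (\<mu> w) dvd f (take i w) * (g (drop i w) - g' (drop i w))"
        "int (\<mu> w) dvd (f (take i w) - f' (take i w)) * g' (drop i w)"
        using that unfolding eqv_def by (meson dvd_mult dvd_mult2 dvd_trans)+
    qed
    finally show "int (\<mu> w) dvd conv f g w - conv f' g' w" .
  qed
  have fin: "finite {w. set w \<subseteq> {..<K} \<and> length w \<le> N}" by (rule finite_lists_length_le) simp
  obtain ws where ws: "set ws = {w. set w \<subseteq> {..<K} \<and> length w \<le> N}"
    using finite_list [OF fin] by (elim exE)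
  obtain enc :: "nat \<Rightarrow> 'e" where enc: "inj enc"
    using infinite_countable_subset [OF inf] by auto
  \<comment> \<open>Only finitely many monomials have a modulus other than 1, so a class is encoded
    by a finite list of residues; \<open>mod 0\<close> is the identity and covers infinite
    orders.\<close>
  define \<rho> where "\<rho> f = enc (to_nat (map (\<lambda>w. f w mod int (\<mu> w)) ws))" for f :: "nat list \<Rightarrow> int"
  have \<rho>_eq: "\<rho> f = \<rho> g \<longleftrightarrow> eqv f g" for f g
  proof -
    have "\<rho> f = \<rho> g \<longleftrightarrow> (\<forall>w\<in>set ws. int (\<mu> w) dvd f w - g w)"
      unfolding \<rho>_def by (simp add: inj_eq [OF enc] mod_eq_dvd_iff)
    also have "\<dots> \<longleftrightarrow> eqv f g" unfolding eqv_def ws by (auto simp: \<mu>_def)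
    finally show ?thesis .
  qed
  define \<theta> where "\<theta> f = lin_comb K b (\<lambda>i. f [i])" for f :: "nat list \<Rightarrow> int"
  have bK: "b \<in> {..<K} \<rightarrow> carrier G" using b by (simp add: K_def)
  have \<theta>_hom: "\<theta> \<in> hom series_group G"
  proof (rule homI)
    show "\<theta> f \<in> carrier G" for f using bK by (simp add: \<theta>_def)
    show "\<theta> (f \<otimes>\<^bsub>series_group\<^esub> g) = \<theta> f \<otimes> \<theta> g"
      if "f \<in> carrier series_group" "g \<in> carrier series_group" for f g
      unfolding \<theta>_def lin_comb_add [OF bK, symmetric] using that
      by (intro lin_comb_cong [OF bK]) (auto simp: conv_Cons)
  qed
  have \<theta>_surj: "\<theta> ` carrier series_group = carrier G"
  proof -
    have "lin_comb K b z \<in> \<theta> ` carrier series_group" for z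
      by (rule image_eqI [of _ _ "\<lambda>w. if w = [] then 1 else z (hd w)"]) (simp_all add: \<theta>_def)
    then have "carrier G \<subseteq> \<theta> ` carrier series_group"
      unfolding span [symmetric] tuple_span_def K_def by blast
    moreover have "\<theta> f \<in> carrier G" for f using bK by (simp add: \<theta>_def)
    ultimately show ?thesis by blast
  qed
  have \<theta>_one: "\<theta> f = \<one> \<longleftrightarrow> (\<forall>i<K. int (n i) dvd f [i])" for f
    unfolding \<theta>_def using rel by (simp add: K_def)
  have \<mu>_letter: "\<mu> [i] = n i" if "i < K" for i using that by (simp add: \<mu>_def N_def)
  define val where "val g = word_value series_group g (outer_comm_word c1 c2)" for g
  have val_leading: "leading N (val g) (lie_outer g c1 c2)" if "\<And>j. g j [] = 1" for g
    unfolding N_def val_def by (rule leading_outer_comm_word) (rule that)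
  \<comment> \<open>Below degree \<open>N\<close> both values have the coefficients of 1, and above
    it every modulus is 1.\<close>
  have val_eqv: "eqv (val g) (val h) \<longleftrightarrow>
      (\<forall>w. length w = N \<longrightarrow> int (\<mu> w) dvd lie_outer g c1 c2 w - lie_outer h c1 c2 w)"
    if "\<And>j. g j [] = 1" "\<And>j. h j [] = 1" for g h
  proof -
    have "int (\<mu> w) dvd val g w - val h w" if "length w \<noteq> N" for w
    proof (cases "length w < N")
      case True
      then show ?thesis using val_leading [of g] val_leading [of h] \<open>\<And>j. g j [] = 1\<close> \<open>\<And>j. h j [] = 1\<close>
        by (cases "w = []") (auto simp: leading_def)
    next
      case False
      then show ?thesis using that by (simp add: \<mu>_def)
    qed
    then show ?thesis unfolding eqv_def
      using val_leading [of g] val_leading [of h] that by (metis leading_def)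
  qed
  have val_cong: "eqv (val g) (val h)"
    if "\<And>j. g j [] = 1" "\<And>j. h j [] = 1" "\<And>j. eqv (g j) (h j)" for g h
  proof -
    have "\<rho> (word_value series_group g v) = \<rho> (word_value series_group h v)" for v
    proof (induction v)
      case (Cons l v)
      have mult: "\<rho> (conv x y) = \<rho> (conv x' y')" if "\<rho> x = \<rho> x'" "\<rho> y = \<rho> y'" for x x' y y'
        using that eqv_conv [of x x' y y'] unfolding \<rho>_eq by simp
      let ?x = "g (fst l)" and ?y = "h (fst l)"
      have xy: "?x \<in> carrier series_group" "?y \<in> carrier series_group" using that by simp_all
      have "\<rho> ?x = \<rho> ?y" unfolding \<rho>_eq by (rule that(3))
      moreover have "\<rho> (inv\<^bsub>series_group\<^esub> ?x) = \<rho> (inv\<^bsub>series_group\<^esub> ?y)"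
      proof -
        \<comment> \<open>Congruent elements have congruent inverses: compare
          \<open>x^-1 y y^-1\<close> with \<open>x^-1 x y^-1\<close>.\<close>
        have "\<rho> (conv (conv (inv\<^bsub>series_group\<^esub> ?x) ?y) (inv\<^bsub>series_group\<^esub> ?y))
            = \<rho> (conv (conv (inv\<^bsub>series_group\<^esub> ?x) ?x) (inv\<^bsub>series_group\<^esub> ?y))"
          using \<open>\<rho> ?x = \<rho> ?y\<close> by (intro mult) simp_all
        moreover have "conv (conv (inv\<^bsub>series_group\<^esub> ?x) ?y) (inv\<^bsub>series_group\<^esub> ?y) = inv\<^bsub>series_group\<^esub> ?x"
          using xy S.m_assoc [of "inv\<^bsub>series_group\<^esub> ?x" ?y "inv\<^bsub>series_group\<^esub> ?y"] S.r_inv [of ?y]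
            S.inv_closed [of ?x] S.inv_closed [of ?y] by simp
        moreover have "conv (conv (inv\<^bsub>series_group\<^esub> ?x) ?x) (inv\<^bsub>series_group\<^esub> ?y) = inv\<^bsub>series_group\<^esub> ?y"
          using S.l_inv [OF xy(1)] by simp
        ultimately show ?thesis by simp
      qed
      ultimately show ?case using Cons by (auto intro!: mult)
    qed simp
    then show ?thesis unfolding val_def \<rho>_eq .
  qed
  have val_marginal: "\<theta> s = \<one> \<longleftrightarrow> (\<forall>g i. (\<forall>j. g j \<in> carrier series_group) \<longrightarrow>
      \<rho> (val (g(i := g i \<otimes>\<^bsub>series_group\<^esub> s))) = \<rho> (val g))"
    if "s \<in> carrier series_group" for s
  proof -
    have s: "s [] = 1" using that by simp
    have "eqv (val (g(i := conv (g i) s))) (val g)"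
      if "\<theta> s = \<one>" and g: "\<forall>j. g j [] = 1" for g i
    proof -
      \<comment> \<open>The truncation of \<open>s\<close> to degree 1 is congruent to 1 if
        \<open>\<theta> s\<close> is trivial, and it gives the same Lie polynomial as
        \<open>s\<close>, which sees linear parts only.\<close>
      define s' where "s' w = (if length w \<le> 1 then s w else 0)" for w
      have s'1: "s' [] = 1" using s by (simp add: s'_def)
      have "eqv s' unit_series"
        unfolding eqv_def
      proof
        fix w
        show "int (\<mu> w) dvd s' w - unit_series w"
        proof (cases "length w = 1")
          case True
          then obtain i where w: "w = [i]" by (auto simp: length_Suc_conv)
          show ?thesis
          proof (cases "i < K")
            case True
            then show ?thesis using \<open>\<theta> s = \<one>\<close> by (simp add: w s'_def unit_series_def \<mu>_letter \<theta>_one)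
          qed (simp add: w \<mu>_def)
        next
          case False
          then have "s' w = unit_series w" using s by (cases w) (auto simp: s'_def unit_series_def)
          then show ?thesis by simp
        qed
      qed
      then have "eqv (conv (g i) s') (conv (g i) unit_series)"
        by (intro eqv_conv) (simp_all add: eqv_def)
      then have "eqv (val (g(i := conv (g i) s'))) (val g)"
        using g s'1 by (intro val_cong) (auto simp: eqv_def)
      moreover have "lie_outer (g(i := conv (g i) s)) c1 c2 w = lie_outer (g(i := conv (g i) s')) c1 c2 w"
        if "length w = N" for w
      proof (rule lie_outer_cong)
        show "(g(i := conv (g i) s)) j w = (g(i := conv (g i) s')) j w" if "length w = 1" for j w
          using that s s'1 by (auto simp: length_Suc_conv conv_Cons s'_def)
      qed (use that in \<open>simp add: N_def\<close>)
      ultimately show ?thesis using val_eqv g s s'1 by simp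
    qed
    moreover have "\<theta> s = \<one>" if inv: "\<And>g i. \<forall>j. g j [] = 1 \<Longrightarrow> eqv (val (g(i := conv (g i) s))) (val g)"
      unfolding \<theta>_one
    proof (intro allI impI)
      fix x assume x: "x < K"
      \<comment> \<open>A second letter whose order is a multiple of that of \<open>x\<close>: the
        last one or, if \<open>x\<close> is the last, its predecessor, which has the same order by
        \<open>eq\<close>.\<close>
      define y where "y = (if x = Suc k then k else Suc k)"
      have y: "y < K" "y \<noteq> x" using x by (auto simp: y_def K_def)
      have "n x dvd n y"
      proof (cases "x = Suc k")
        case False
        have "n x dvd n (x + d)" if "x + d \<le> Suc k" for d
          using that
        proof (induction d)
          case (Suc d)
          then show ?case using chain [of "x + d"] by (auto intro: dvd_trans)
        qed simp
        from this [of "Suc k - x"] show ?thesis using x False by (simp add: y_def K_def)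
      qed (simp add: y_def eq)
      \<comment> \<open>The series \<open>1 + X_i\<close>. In \<open>g\<close> the slots 1 to
        \<open>Suc c1\<close> receive \<open>y\<close>, including the first slot of the second
        commutator.\<close>
      define letter where "letter i w = (if w = [] \<or> w = [i] then 1 else 0::int)" for i :: nat and w
      define g where "g j = (if j = 0 then unit_series else if j \<le> Suc c1 then letter y else letter x)" for j
      have g1: "\<forall>j. g j [] = 1" by (simp add: g_def letter_def)
      let ?w = "x # replicate (Suc c1) y @ replicate c2 x"
      have coeff: "lie_outer (g(0 := f)) c1 c2 ?w = f [x]" for f
        using lie_outer_coeff [OF c, of "g(0 := f)" x y] y by (simp add: g_def letter_def)
      have "eqv (val (g(0 := conv (g 0) s))) (val g)" using g1 by (rule inv)
      then have "\<forall>w. length w = N \<longrightarrow>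
          int (\<mu> w) dvd lie_outer (g(0 := conv (g 0) s)) c1 c2 w - lie_outer g c1 c2 w"
        by (rule iffD1 [OF val_eqv, rotated -1]) (use g1 s in auto)
      then have "int (\<mu> ?w) dvd lie_outer (g(0 := conv (g 0) s)) c1 c2 ?w - lie_outer g c1 c2 ?w"
        by (rule allE [of _ ?w]) (simp add: N_def)
      moreover have "lie_outer (g(0 := conv (g 0) s)) c1 c2 ?w = s [x]"
        unfolding coeff by (simp add: g_def)
      moreover have "lie_outer g c1 c2 ?w = g 0 [x]"
        using coeff [of "g 0", unfolded fun_upd_triv] .
      moreover have "g 0 [x] = 0" by (simp add: g_def unit_series_def)
      ultimately have dvd_s: "int (\<mu> ?w) dvd s [x]" by simp
      have set_w: "set ?w = {x, y}" by (auto simp: set_replicate_conv_if)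
      \<comment> \<open>The detecting monomial contains only \<open>x\<close> and \<open>y\<close>,
        so its modulus is a multiple of \<open>n x\<close> and no information on
        \<open>s [x]\<close> modulo \<open>n x\<close> is lost.\<close>
      have "\<mu> ?w = Gcd (n ` {x, y})" using x y unfolding \<mu>_def set_w by (simp add: N_def)
      then have "n x dvd \<mu> ?w" using \<open>n x dvd n y\<close> by simp
      then have "int (n x) dvd int (\<mu> ?w)" by simp
      then show "int (n x) dvd s [x]" using dvd_s by (rule dvd_trans)
    qed
    ultimately show ?thesis
      unfolding \<rho>_eq series_group_sel mem_Collect_eq by blast
  qed
  show ?thesis
  proof (rule variety_capableI [OF group_series_group group_axioms _ \<theta>_hom \<theta>_surj])
    show "\<rho> (x \<otimes>\<^bsub>series_group\<^esub> y) = \<rho> (x' \<otimes>\<^bsub>series_group\<^esub> y')"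
      if "\<rho> x = \<rho> x'" "\<rho> y = \<rho> y'" for x x' y y'
      using that eqv_conv [of x x' y y'] unfolding \<rho>_eq by simp
    show "\<theta> f = \<theta> g" if "f \<in> carrier series_group" "g \<in> carrier series_group" "\<rho> f = \<rho> g" for f g
    proof -
      have "int (n i) dvd f [i] - g [i]" if "i < K" for i
      proof -
        have "int (\<mu> [i]) dvd f [i] - g [i]"
          using \<open>\<rho> f = \<rho> g\<close> unfolding \<rho>_eq eqv_def by (rule spec)
        then show ?thesis using \<mu>_letter [OF that] by simp
      qed
      then have "lin_comb K b (\<lambda>i. f [i] - g [i]) = \<one>" using rel by (simp add: K_def)
      then show ?thesis
        using lin_comb_add [OF bK, of "\<lambda>i. f [i] - g [i]" "\<lambda>i. g [i]"] bK by (simp add: \<theta>_def)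
    qed
    show "\<theta> s = \<one> \<longleftrightarrow> (\<forall>g i. (\<forall>j. g j \<in> carrier series_group) \<longrightarrow>
        \<rho> (word_value series_group (g(i := g i \<otimes>\<^bsub>series_group\<^esub> s)) (outer_comm_word c1 c2))
          = \<rho> (word_value series_group g (outer_comm_word c1 c2)))"
      if "s \<in> carrier series_group" for s
      using val_marginal [OF that] unfolding val_def .
  qed
qed

section \<open>Ordinary capability as a special case, and the equivalence\<close>

lemma capable_eq_variety_capable: "capable T G = variety_capable T {outer_comm_word 0 0} G"
  unfolding capable_def variety_capable_def by (metis group.center_eq_marginal)

theorem mainTheorem4:
  fixes G :: "('a, 'm) monoid_scheme" and c1 c2 :: nat
  assumes "infinite (UNIV :: 'b set)" and "infinite (UNIV :: 'c set)"
    and "c1 \<ge> 1" and "c2 \<ge> 1" and "c2 \<le> c1" and "c1 \<le> 2 * c2" and "c1 \<noteq> 1" and "c2 \<noteq> 1"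
    and "comm_group G" and "finitely_generated G"
  shows "variety_capable TYPE('b) {outer_comm_word c1 c2} G \<longleftrightarrow> capable TYPE('c) G"
proof -
  interpret comm_group G by fact
  obtain b k n where b: "b \<in> {..<Suc (Suc k)} \<rightarrow> carrier G"
    "tuple_span (Suc (Suc k)) b = carrier G"
    "\<And>z. lin_comb (Suc (Suc k)) b z = \<one>\<^bsub>G\<^esub> \<longleftrightarrow> (\<forall>i<Suc (Suc k). int (n i) dvd z i)"
    "\<And>i. i \<le> k \<Longrightarrow> n i dvd n (Suc i)"
    by (fact finitely_generated_diagonal_basis [OF \<open>finitely_generated G\<close>])
  \<comment> \<open>Stated for all weights and witness types, since it serves both the given word
    and the word \<open>[x, y]\<close> of ordinary capability.\<close>
  have necessary: "n (Suc k) = n k" if "variety_capable T {outer_comm_word d1 d2} G" for T :: "'d itself" and d1 d2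
  proof -
    obtain E :: "'d monoid" where E: "group E" "G \<cong> E Mod marginal {outer_comm_word d1 d2} E"
      using \<open>variety_capable T {outer_comm_word d1 d2} G\<close> unfolding variety_capable_def by (elim exE conjE)
    show ?thesis
      by (rule invariants_eq_of_marginal_quotient [OF b
            outer_commutator_outer_comm_word [of d1 d2, unfolded outer_comm_word_def]
            E [unfolded outer_comm_word_def]])
  qed
  show ?thesis
    unfolding capable_eq_variety_capable
  proof
    show "variety_capable TYPE('c) {outer_comm_word 0 0} G" if "variety_capable TYPE('b) {outer_comm_word c1 c2} G"
      by (rule variety_capable_of_invariants_eq [OF \<open>infinite (UNIV :: 'c set)\<close> _ _ b necessary [OF that]]) simp_all
    show "variety_capable TYPE('b) {outer_comm_word c1 c2} G" if "variety_capable TYPE('c) {outer_comm_word 0 0} G"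
      by (rule variety_capable_of_invariants_eq [OF \<open>infinite (UNIV :: 'b set)\<close> \<open>c2 \<le> c1\<close> \<open>c2 \<noteq> 1\<close> b necessary [OF that]])
  qed
qed

end
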